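(* Let $A$ be weakly $2$-generic. Then almost every set (with respect to the uniform measure on $2^\omega$) computes a set that is weakly $1$-generic relative to $A$, and hence $A$ is dispersive. In fact, almost every set computes a set that is weakly $1$-generic relative to every weakly $2$-generic set.
   Context: A set $G$ is weakly $1$-generic relative to $A$ if $G$ has an initial segment in every dense set of binary strings that is c.e. relative to $A$. $A$ is weakly $2$-generic if it has an initial segment in every dense set of binary strings that is c.e. relative to $\emptyset'$. For $X\subseteq\omega$, $\rho_n(X)=|X\cap[0,n)|/n$, $\overline{\rho}(X)=\limsup_n\rho_n(X)$; coarse similarity classes $[X]$ (where $X\sim Y$ iff $\lim_n\rho_n(X\bigtriangleup Y)=0$) form the metric space $(\mathcal{S},\delta)$ with $\delta([X],[Y])=\overline{\rho}(X\bigtriangleup Y)$. $H(A,B)$ is the Hausdorff distance in $(\mathcal{S},\delta)$ between the closures of $\{[X]:X\le_T A\}$ and $\{[X]:X\le_T B\}$. $A$ is dispersive if the class of $B$ with $H(A,B)=1/2$ does not have measure $1$. *)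

theory Defs
  imports
    "HOL-Probability.Probability"
    "HOL-Library.Nat_Bijection"
    "HOL-Library.Sublist"
begin

section \<open>Oracle computability\<close>

text \<open>
  The partial functions on the natural numbers that are computable with oracle \<open>A\<close> are those obtained
  from zero, successor, the two inverse pairing functions and the characteristic function of
  \<open>A\<close> by pairing, composition, primitive recursion and minimisation.  All functions
  are unary; further arguments are passed through the Cantor pairing \<^const>\<open>prod_encode\<close>.
\<close>

datatype code =
    Zero | Succ | Fst | Snd | Query
  | Pairing code code | Comp code code | PrimRec code code | Minim code

primrec eval :: "nat set \<Rightarrow> code \<Rightarrow> nat \<Rightarrow> nat option" where
  "eval A Zero = (\<lambda>n. Some 0)"
| "eval A Succ = (\<lambda>n. Some (Suc n))"
| "eval A Fst = (\<lambda>n. Some (fst (prod_decode n)))"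
| "eval A Snd = (\<lambda>n. Some (snd (prod_decode n)))"
| "eval A Query = (\<lambda>n. Some (of_bool (n \<in> A)))"
| "eval A (Pairing p q) = (\<lambda>n.
     Option.bind (eval A p n) (\<lambda>x.
     Option.bind (eval A q n) (\<lambda>y. Some (prod_encode (x, y)))))"
| "eval A (Comp p q) = (\<lambda>n. Option.bind (eval A q n) (eval A p))"
| "eval A (PrimRec p q) = (\<lambda>n. case prod_decode n of (a, k) \<Rightarrow>
     rec_nat (eval A p a)
       (\<lambda>i r. Option.bind r (\<lambda>y. eval A q (prod_encode (a, prod_encode (i, y))))) k)"
| "eval A (Minim p) = (\<lambda>n.
     let hit = (\<lambda>k. eval A p (prod_encode (n, k)) = Some 0 \<and>
                     (\<forall>i<k. \<exists>y>0. eval A p (prod_encode (n, i)) = Some y))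
     in if \<exists>k. hit k then Some (THE k. hit k) else None)"

definition turing_reducible :: "nat set \<Rightarrow> nat set \<Rightarrow> bool"  (infix "\<le>\<^sub>T" 50) where
  "X \<le>\<^sub>T A \<longleftrightarrow> (\<exists>p. \<forall>n. eval A p n = Some (of_bool (n \<in> X)))"

definition ce_in :: "nat set \<Rightarrow> nat set \<Rightarrow> bool" where
  "ce_in A W \<longleftrightarrow> (\<exists>p. W = dom (eval A p))"

primrec code_num :: "code \<Rightarrow> nat" where
  "code_num Zero = 0"
| "code_num Succ = 1"
| "code_num Fst = 2"
| "code_num Snd = 3"
| "code_num Query = 4"
| "code_num (Pairing p q) = 5 + 4 * prod_encode (code_num p, code_num q)"
| "code_num (Comp p q) = 6 + 4 * prod_encode (code_num p, code_num q)"
| "code_num (PrimRec p q) = 7 + 4 * prod_encode (code_num p, code_num q)"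
| "code_num (Minim p) = 8 + 4 * code_num p"

definition turing_jump :: "nat set \<Rightarrow> nat set" where
  "turing_jump A = {code_num p | p. eval A p (code_num p) \<noteq> None}"


section \<open>Weak genericity\<close>

definition string_num :: "bool list \<Rightarrow> nat" where
  "string_num s = list_encode (map of_bool s)"

definition ce_strings_in :: "nat set \<Rightarrow> bool list set \<Rightarrow> bool" where
  "ce_strings_in A D \<longleftrightarrow> ce_in A (string_num ` D)"

definition dense_strings :: "bool list set \<Rightarrow> bool" where
  "dense_strings D \<longleftrightarrow> (\<forall>s. \<exists>t\<in>D. prefix s t)"

definition initial_segment :: "nat set \<Rightarrow> nat \<Rightarrow> bool list" where
  "initial_segment G n = map (\<lambda>i. i \<in> G) [0..<n]"

definition weakly_1_generic_in :: "nat set \<Rightarrow> nat set \<Rightarrow> bool" where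
  "weakly_1_generic_in A G \<longleftrightarrow>
     (\<forall>D. dense_strings D \<and> ce_strings_in A D \<longrightarrow> (\<exists>n. initial_segment G n \<in> D))"

definition weakly_2_generic :: "nat set \<Rightarrow> bool" where
  "weakly_2_generic G \<longleftrightarrow>
     (\<forall>D. dense_strings D \<and> ce_strings_in (turing_jump {}) D \<longrightarrow> (\<exists>n. initial_segment G n \<in> D))"


section \<open>The space of coarse similarity classes\<close>

definition partial_density :: "nat \<Rightarrow> nat set \<Rightarrow> real" where
  "partial_density n X = real (card (X \<inter> {0..<n})) / real n"

definition upper_density :: "nat set \<Rightarrow> real" where
  "upper_density X = real_of_ereal (limsup (\<lambda>n. ereal (partial_density n X)))"

definition coarsely_similar :: "nat set \<Rightarrow> nat set \<Rightarrow> bool" where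
  "coarsely_similar X Y \<longleftrightarrow> (\<lambda>n. partial_density n (sym_diff X Y)) \<longlonglongrightarrow> 0"

lemma partial_density_nonneg: "0 \<le> partial_density n X"
  by (simp add: partial_density_def)

lemma partial_density_le_1: "partial_density n X \<le> 1"
proof -
  have "card (X \<inter> {0..<n}) \<le> card {0..<n}"
    by (intro card_mono) auto
  then show ?thesis
    by (simp add: partial_density_def divide_le_eq)
qed

lemma partial_density_triangle:
  "partial_density n (sym_diff X Z) \<le>
     partial_density n (sym_diff X Y) + partial_density n (sym_diff Y Z)"
proof -
  have "card (sym_diff X Z \<inter> {0..<n}) \<le>
          card ((sym_diff X Y \<inter> {0..<n}) \<union> (sym_diff Y Z \<inter> {0..<n}))"
    by (intro card_mono) auto
  also have "\<dots> \<le> card (sym_diff X Y \<inter> {0..<n}) + card (sym_diff Y Z \<inter> {0..<n})"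
    by (rule card_Un_le)
  finally show ?thesis
    unfolding partial_density_def add_divide_distrib [symmetric]
    by (intro divide_right_mono) auto
qed

lemma limsup_partial_density_bounds:
  "0 \<le> limsup (\<lambda>n. ereal (partial_density n X))"
  "limsup (\<lambda>n. ereal (partial_density n X)) \<le> 1"
proof -
  have "0 \<le> liminf (\<lambda>n. ereal (partial_density n X))"
    by (intro Liminf_bounded) (simp add: partial_density_nonneg)
  also have "\<dots> \<le> limsup (\<lambda>n. ereal (partial_density n X))"
    by (intro Liminf_le_Limsup) simp
  finally show "0 \<le> limsup (\<lambda>n. ereal (partial_density n X))" .
  show "limsup (\<lambda>n. ereal (partial_density n X)) \<le> 1"
    by (intro Limsup_bounded) (simp add: partial_density_le_1)
qed

lemma ereal_upper_density:
  "ereal (upper_density X) = limsup (\<lambda>n. ereal (partial_density n X))"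
  unfolding upper_density_def
  using limsup_partial_density_bounds [of X] by (intro ereal_real') auto

lemma upper_density_triangle:
  "upper_density (sym_diff X Z) \<le> upper_density (sym_diff X Y) + upper_density (sym_diff Y Z)"
proof -
  have "ereal (upper_density (sym_diff X Z)) \<le>
      limsup (\<lambda>n. ereal (partial_density n (sym_diff X Y)) + ereal (partial_density n (sym_diff Y Z)))"
    unfolding ereal_upper_density
    by (intro Limsup_mono always_eventually) (simp add: partial_density_triangle)
  also have "\<dots> \<le> ereal (upper_density (sym_diff X Y)) + ereal (upper_density (sym_diff Y Z))"
    unfolding ereal_upper_density by (rule ereal_limsup_add_mono)
  finally show ?thesis by simp
qed

lemma coarsely_similar_iff: "coarsely_similar X Y \<longleftrightarrow> upper_density (sym_diff X Y) = 0"
proof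
  let ?f = "\<lambda>n. ereal (partial_density n (sym_diff X Y))"
  assume "coarsely_similar X Y"
  then have "?f \<longlonglongrightarrow> ereal 0"
    unfolding coarsely_similar_def by simp
  then have "limsup ?f = 0"
    by (simp add: lim_imp_Limsup zero_ereal_def)
  then show "upper_density (sym_diff X Y) = 0"
    by (simp add: upper_density_def)
next
  let ?f = "\<lambda>n. ereal (partial_density n (sym_diff X Y))"
  assume "upper_density (sym_diff X Y) = 0"
  then have 1: "limsup ?f = 0"
    using ereal_upper_density [of "sym_diff X Y"] by (metis zero_ereal_def)
  have "0 \<le> liminf ?f"
    by (intro Liminf_bounded) (simp add: partial_density_nonneg)
  moreover have "liminf ?f \<le> limsup ?f"
    by (intro Liminf_le_Limsup) simp
  ultimately have "liminf ?f = 0"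
    using 1 by simp
  with 1 have "?f \<longlonglongrightarrow> ereal 0"
    by (intro Liminf_eq_Limsup) (simp_all add: zero_ereal_def)
  then show "coarsely_similar X Y"
    unfolding coarsely_similar_def by simp
qed

lemma upper_density_nonneg: "0 \<le> upper_density X"
  using limsup_partial_density_bounds(1) [of X]
  by (simp add: upper_density_def real_of_ereal_pos)

lemma coarsely_similar_trans:
  "coarsely_similar X Y \<Longrightarrow> coarsely_similar Y Z \<Longrightarrow> coarsely_similar X Z"
  using upper_density_triangle [of X Z Y] upper_density_nonneg [of "sym_diff X Z"]
  by (simp add: coarsely_similar_iff)

lemma coarsely_similar_sym: "coarsely_similar X Y \<Longrightarrow> coarsely_similar Y X"
  by (simp add: coarsely_similar_def Un_commute)

quotient_type coarse_class = "nat set" / coarsely_similar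
  morphisms rep_coarse_class coarse_class
proof (rule equivpI)
  show "reflp coarsely_similar"
    by (rule reflpI) (simp add: coarsely_similar_def partial_density_def)
  show "symp coarsely_similar"
    by (rule sympI) (rule coarsely_similar_sym)
  show "transp coarsely_similar"
    by (rule transpI) (rule coarsely_similar_trans)
qed

lemma upper_density_cong:
  assumes "coarsely_similar X X'" "coarsely_similar Y Y'"
  shows "upper_density (sym_diff X Y) \<le> upper_density (sym_diff X' Y')"
proof -
  have "upper_density (sym_diff X Y) \<le>
      upper_density (sym_diff X X') + (upper_density (sym_diff X' Y') + upper_density (sym_diff Y' Y))"
    using upper_density_triangle [of X Y X'] upper_density_triangle [of X' Y Y'] by linarith
  then show ?thesis
    using assms(1) coarsely_similar_sym [OF assms(2)] by (simp add: coarsely_similar_iff)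
qed

instantiation coarse_class :: metric_space
begin

lift_definition dist_coarse_class :: "coarse_class \<Rightarrow> coarse_class \<Rightarrow> real"
  is "\<lambda>X Y. upper_density (sym_diff X Y)"
  by (intro antisym upper_density_cong) (auto intro: coarsely_similar_sym)

definition uniformity_coarse_class :: "(coarse_class \<times> coarse_class) filter" where
  "uniformity_coarse_class = (INF e\<in>{0<..}. principal {(x, y). dist x y < e})"

definition open_coarse_class :: "coarse_class set \<Rightarrow> bool" where
  "open_coarse_class U \<longleftrightarrow> (\<forall>x\<in>U. eventually (\<lambda>(x', y). x' = x \<longrightarrow> y \<in> U) uniformity)"

instance
proof
  fix x y z :: coarse_class
  show "dist x y = 0 \<longleftrightarrow> x = y"
    by transfer (simp add: coarsely_similar_iff)
  have sym: "dist a b = dist b a" for a b :: coarse_class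
    by transfer (simp add: Un_commute)
  have "dist x y \<le> dist x z + dist z y"
    by transfer (rule upper_density_triangle)
  then show "dist x y \<le> dist x z + dist y z"
    by (simp add: sym)
qed (rule uniformity_coarse_class_def open_coarse_class_def)+

end


section \<open>Hausdorff distance between degrees, dispersiveness\<close>

text \<open>Only meaningful for nonempty bounded sets; \<open>coarse_class\<close> has diameter at most 1.\<close>

definition hausdorff_distance :: "'a::metric_space set \<Rightarrow> 'a set \<Rightarrow> real" where
  "hausdorff_distance S T = max (SUP x\<in>S. infdist x T) (SUP y\<in>T. infdist y S)"

definition degree_distance :: "nat set \<Rightarrow> nat set \<Rightarrow> real" where
  "degree_distance A B =
     hausdorff_distance (closure (coarse_class ` {X. X \<le>\<^sub>T A}))
                        (closure (coarse_class ` {X. X \<le>\<^sub>T B}))"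

text \<open>The fair-coin product measure, transported from characteristic functions to sets.\<close>

definition uniform_measure_sets :: "nat set measure" where
  "uniform_measure_sets =
     embed_measure (\<Pi>\<^sub>M n\<in>(UNIV :: nat set). measure_pmf (bernoulli_pmf (1/2))) Collect"

text \<open>A class of sets has measure 1 (for the completed measure) iff almost every set belongs to it.\<close>

definition dispersive :: "nat set \<Rightarrow> bool" where
  "dispersive A \<longleftrightarrow> \<not> (AE B in uniform_measure_sets. degree_distance A B = 1/2)"

end

theory Submission
  imports Defs
begin

text \<open>
  Requirement \<open>j = (p, \<sigma>)\<close> asks for a string \<open>\<tau>\<close> extending \<open>\<sigma>\<close> such that the set computed
  by the random set \<open>B\<close> has an initial segment in the set enumerated by the program \<open>p\<close> with oracle \<open>\<tau>\<close>.
  A computable construction, which does not look at \<open>B\<close>, runs attempts for every \<open>j\<close>: an attempt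
  made at length \<open>n\<close> searches for an extension of the current \<open>\<tau>\<close> for which every string of length
  \<open>n\<close> has an extension enumerated by \<open>p\<close>, and at most \<open>2 ^ (j + c)\<close> attempts are made unless a
  requirement of higher priority intervenes.  The first \<open>j + c\<close> bits of \<open>B\<close> choose the one attempt
  for whose success \<open>B\<close> waits.  At most one attempt for \<open>j\<close> is pending forever, so the sets \<open>B\<close>
  that get stuck have measure at most \<open>(\<Sum>j. 2 powr - (j + c))\<close>, which tends to \<open>0\<close> with growing \<open>c\<close>.

  The injuries being finite, the string \<open>\<tau>\<close> of each requirement reaches a limit.  For fixed \<open>p\<close> these
  limits form a dense set that is c.e. in the halting problem, so a weakly 2-generic \<open>A\<close> extends one
  of them.  If \<open>p\<close> with oracle \<open>A\<close> enumerates a dense set, then all the attempts for this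
  requirement succeed, and every \<open>B\<close> that does not get stuck meets the set.

  A set that is weakly 1-generic relative to \<open>A\<close> has upper density distance 1 from every
  \<open>A\<close>-computable set, which gives dispersiveness.
\<close>

section \<open>Computable functions\<close>

abbreviation pair1 :: "nat \<Rightarrow> nat" where "pair1 z \<equiv> fst (prod_decode z)"
abbreviation pair2 :: "nat \<Rightarrow> nat" where "pair2 z \<equiv> snd (prod_decode z)"

definition computable_in :: "nat set \<Rightarrow> (nat \<Rightarrow> nat) \<Rightarrow> bool" where
  "computable_in A f \<longleftrightarrow> (\<exists>p. \<forall>n. eval A p n = Some (f n))"

abbreviation decidable_in :: "nat set \<Rightarrow> (nat \<Rightarrow> bool) \<Rightarrow> bool" where
  "decidable_in A P \<equiv> computable_in A (\<lambda>n. of_bool (P n))"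

lemma turing_reducible_iff: "X \<le>\<^sub>T A \<longleftrightarrow> decidable_in A (\<lambda>n. n \<in> X)"
  by (simp add: turing_reducible_def computable_in_def)

text \<open>With these closure rules \<open>intro computable\<close> follows the syntax of a term. A
  term in several variables is first turned into a function of one coded tuple, by
  \<open>computable_binary\<close> and its variants.\<close>

named_theorems computable

lemma computable_comp:
  assumes "computable_in A f" "computable_in A g"
  shows "computable_in A (\<lambda>n. f (g n))"
proof -
  obtain p q where "\<forall>n. eval A p n = Some (f n)" "\<forall>n. eval A q n = Some (g n)"
    using assms by (auto simp: computable_in_def)
  then have "\<forall>n. eval A (Comp p q) n = Some (f (g n))" by simp
  then show ?thesis unfolding computable_in_def by blast
qed

lemma computable_pair [computable]:
  assumes "computable_in A f" "computable_in A g"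
  shows "computable_in A (\<lambda>n. prod_encode (f n, g n))"
proof -
  obtain p q where "\<forall>n. eval A p n = Some (f n)" "\<forall>n. eval A q n = Some (g n)"
    using assms by (auto simp: computable_in_def)
  then have "\<forall>n. eval A (Pairing p q) n = Some (prod_encode (f n, g n))" by simp
  then show ?thesis unfolding computable_in_def by blast
qed

lemma computable_id [computable]: "computable_in A (\<lambda>n. n)"
proof -
  have "\<forall>n. eval A (Pairing Fst Snd) n = Some n" by simp
  then show ?thesis unfolding computable_in_def by blast
qed

lemma computable_Suc [computable]:
  assumes "computable_in A f" shows "computable_in A (\<lambda>n. Suc (f n))"
proof -
  have "\<forall>n. eval A Succ n = Some (Suc n)" by simp
  then have "computable_in A Suc" unfolding computable_in_def by blast
  from computable_comp [OF this assms] show ?thesis .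
qed

lemma computable_const [computable]: "computable_in A (\<lambda>n. c)"
proof (induction c)
  case 0
  have "\<forall>n. eval A Zero n = Some 0" by simp
  then show ?case unfolding computable_in_def by blast
qed (rule computable_Suc)

lemma computable_pair1 [computable]:
  assumes "computable_in A f" shows "computable_in A (\<lambda>n. pair1 (f n))"
proof -
  have "\<forall>n. eval A Fst n = Some (pair1 n)" by simp
  then have "computable_in A pair1" unfolding computable_in_def by blast
  from computable_comp [OF this assms] show ?thesis .
qed

lemma computable_pair2 [computable]:
  assumes "computable_in A f" shows "computable_in A (\<lambda>n. pair2 (f n))"
proof -
  have "\<forall>n. eval A Snd n = Some (pair2 n)" by simp
  then have "computable_in A pair2" unfolding computable_in_def by blast
  from computable_comp [OF this assms] show ?thesis .
qed

lemma decidable_oracle: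
  assumes "computable_in A f" shows "decidable_in A (\<lambda>n. f n \<in> A)"
proof -
  have "\<forall>n. eval A Query n = Some (of_bool (n \<in> A))" by simp
  then have "decidable_in A (\<lambda>n. n \<in> A)" unfolding computable_in_def by blast
  from computable_comp [OF this assms] show ?thesis .
qed

lemma computable_binary:
  assumes "computable_in A (\<lambda>z. F (pair1 z) (pair2 z))" "computable_in A f" "computable_in A g"
  shows "computable_in A (\<lambda>n. F (f n) (g n))"
  using computable_comp [OF assms(1) computable_pair [OF assms(2,3)]] by simp

lemma computable_ternary:
  assumes "computable_in A (\<lambda>z. F (pair1 z) (pair1 (pair2 z)) (pair2 (pair2 z)))"
    "computable_in A f" "computable_in A g" "computable_in A h"
  shows "computable_in A (\<lambda>n. F (f n) (g n) (h n))"
  using computable_comp [OF assms(1) computable_pair [OF assms(2) computable_pair [OF assms(3,4)]]]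
  by simp

lemma computable_quaternary:
  assumes "computable_in A (\<lambda>z. F (pair1 z) (pair1 (pair2 z)) (pair1 (pair2 (pair2 z)))
      (pair2 (pair2 (pair2 z))))"
    "computable_in A f" "computable_in A g" "computable_in A h" "computable_in A k"
  shows "computable_in A (\<lambda>n. F (f n) (g n) (h n) (k n))"
  using computable_comp [OF assms(1) computable_pair [OF assms(2) computable_pair
      [OF assms(3) computable_pair [OF assms(4,5)]]]]
  by simp

text \<open>\<open>PrimRec\<close> recurses on the second half of a pair and hands the first half on
  unchanged, so the parameter \<open>n\<close> stays available in every step.\<close>

lemma computable_rec_nat [computable]:
  assumes "computable_in A b"
    "computable_in A (\<lambda>z. st (pair1 z) (pair1 (pair2 z)) (pair2 (pair2 z)))"
    "computable_in A k"
  shows "computable_in A (\<lambda>n. rec_nat (b n) (st n) (k n))"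
proof -
  obtain p q where p: "\<And>n. eval A p n = Some (b n)"
    and q: "\<And>z. eval A q z = Some (st (pair1 z) (pair1 (pair2 z)) (pair2 (pair2 z)))"
    using assms(1,2) by (auto simp: computable_in_def)
  have "eval A (PrimRec p q) z = Some (rec_nat (b (pair1 z)) (st (pair1 z)) (pair2 z))" for z
  proof -
    obtain a m where z: "prod_decode z = (a, m)" by fastforce
    have "rec_nat (eval A p a)
       (\<lambda>i r. Option.bind r (\<lambda>y. eval A q (prod_encode (a, prod_encode (i, y))))) m
       = Some (rec_nat (b a) (st a) m)"
      by (induction m) (simp_all add: p q)
    then show ?thesis by (simp add: z)
  qed
  then have "computable_in A (\<lambda>z. rec_nat (b (pair1 z)) (st (pair1 z)) (pair2 z))"
    unfolding computable_in_def by blast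
  then show ?thesis
    by (rule computable_binary [OF _ computable_id assms(3)])
qed

lemma computable_add [computable]:
  assumes "computable_in A f" "computable_in A g"
  shows "computable_in A (\<lambda>n. f n + g n)"
proof -
  have "rec_nat a (\<lambda>i r. Suc r) b = a + b" for a b :: nat by (induction b) auto
  moreover have "computable_in A (\<lambda>n. rec_nat (f n) (\<lambda>i r. Suc r) (g n))"
    by (intro computable assms)
  ultimately show ?thesis by simp
qed

lemma computable_mult [computable]:
  assumes "computable_in A f" "computable_in A g"
  shows "computable_in A (\<lambda>n. f n * g n)"
proof (rule computable_binary [OF _ assms])
  have "rec_nat 0 (\<lambda>i r. r + a) b = a * b" for a b :: nat by (induction b) auto
  moreover have "computable_in A (\<lambda>z. rec_nat 0 (\<lambda>i r. r + pair1 z) (pair2 z))"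
    by (intro computable)
  ultimately show "computable_in A (\<lambda>z. pair1 z * pair2 z)" by simp
qed

lemma computable_power [computable]:
  assumes "computable_in A f" "computable_in A g"
  shows "computable_in A (\<lambda>n. f n ^ g n)"
proof (rule computable_binary [OF _ assms])
  have "rec_nat 1 (\<lambda>i r. r * a) b = a ^ b" for a b :: nat by (induction b) auto
  moreover have "computable_in A (\<lambda>z. rec_nat 1 (\<lambda>i r. r * pair1 z) (pair2 z))"
    by (intro computable)
  ultimately show "computable_in A (\<lambda>z. pair1 z ^ pair2 z)" by simp
qed

lemma computable_diff [computable]:
  assumes "computable_in A f" "computable_in A g"
  shows "computable_in A (\<lambda>n. f n - g n)"
proof (rule computable_binary [OF _ assms])
  \<comment> \<open>The predecessor is the recursion that returns the index of its last
    step.\<close>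
  have pred: "rec_nat 0 (\<lambda>i r. i) b = b - 1" for b :: nat by (cases b) auto
  have "rec_nat a (\<lambda>i r. rec_nat 0 (\<lambda>i r. i) r) b = a - b" for a b :: nat
    by (induction b) (auto simp: pred)
  moreover have "computable_in A (\<lambda>z. rec_nat (pair1 z) (\<lambda>i r. rec_nat 0 (\<lambda>i r. i) r) (pair2 z))"
    by (intro computable)
  ultimately show "computable_in A (\<lambda>z. pair1 z - pair2 z)" by simp
qed

lemma decidable_not [computable]:
  assumes "decidable_in A P" shows "decidable_in A (\<lambda>n. \<not> P n)"
proof -
  have "computable_in A (\<lambda>n. 1 - of_bool (P n))" by (intro computable assms)
  moreover have "(\<lambda>n. 1 - of_bool (P n)) = (\<lambda>n. of_bool (\<not> P n) :: nat)" by auto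
  ultimately show ?thesis by simp
qed

lemma decidable_conj [computable]:
  assumes "decidable_in A P" "decidable_in A Q" shows "decidable_in A (\<lambda>n. P n \<and> Q n)"
  using computable_mult [OF assms] by (simp add: of_bool_conj)

lemma decidable_disj [computable]:
  assumes "decidable_in A P" "decidable_in A Q" shows "decidable_in A (\<lambda>n. P n \<or> Q n)"
  using decidable_not [OF decidable_conj [OF assms [THEN decidable_not]]]
  by (simp only: de_Morgan_conj not_not)

lemma decidable_imp [computable]:
  assumes "decidable_in A P" "decidable_in A Q" shows "decidable_in A (\<lambda>n. P n \<longrightarrow> Q n)"
  using decidable_disj [OF decidable_not [OF assms(1)] assms(2)] by (simp only: imp_conv_disj)

lemma computable_If [computable]:
  assumes "decidable_in A P" "computable_in A f" "computable_in A g"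
  shows "computable_in A (\<lambda>n. if P n then f n else g n)"
proof -
  have "computable_in A (\<lambda>n. of_bool (P n) * f n + of_bool (\<not> P n) * g n)"
    by (intro computable assms)
  moreover have "(\<lambda>n. of_bool (P n) * f n + of_bool (\<not> P n) * g n) = (\<lambda>n. if P n then f n else g n)"
    by auto
  ultimately show ?thesis by simp
qed

lemma decidable_le [computable]:
  assumes "computable_in A f" "computable_in A g" shows "decidable_in A (\<lambda>n. f n \<le> g n)"
proof -
  have "computable_in A (\<lambda>n. 1 - (f n - g n))" by (intro computable assms)
  moreover have "(\<lambda>n. 1 - (f n - g n)) = (\<lambda>n. of_bool (f n \<le> g n))" by auto
  ultimately show ?thesis by simp
qed

lemma decidable_less [computable]:
  assumes "computable_in A f" "computable_in A g" shows "decidable_in A (\<lambda>n. f n < g n)"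
  using decidable_le [OF computable_Suc [OF assms(1)] assms(2)] by (simp add: Suc_le_eq)

lemma decidable_eq [computable]:
  assumes "computable_in A f" "computable_in A g" shows "decidable_in A (\<lambda>n. f n = g n)"
  using decidable_conj [OF decidable_le [OF assms] decidable_le [OF assms(2,1)]]
  by (simp only: eq_iff)

lemma computable_max [computable]:
  assumes "computable_in A f" "computable_in A g"
  shows "computable_in A (\<lambda>n. max (f n) (g n))"
  unfolding max_def by (intro computable assms)

section \<open>Unbounded and bounded search\<close>

lemma eval_Minim:
  assumes "\<And>z. eval A p z = Some (of_bool (\<not> P (pair1 z) (pair2 z)))"
  shows "eval A (Minim p) n = (if \<exists>k. P n k then Some (LEAST k. P n k) else None)"
proof -
  define hit where "hit = (\<lambda>k. eval A p (prod_encode (n, k)) = Some 0 \<and>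
                     (\<forall>i<k. \<exists>y>0. eval A p (prod_encode (n, i)) = Some y))"
  \<comment> \<open>\<open>p\<close> is total and outputs 0 exactly where \<open>P\<close> holds, so
    the side condition on earlier outputs says only that there is no smaller witness.\<close>
  have hit: "hit k \<longleftrightarrow> P n k \<and> (\<forall>i<k. \<not> P n i)" for k
    by (auto simp: hit_def assms)
  have "(\<exists>k. hit k) \<longleftrightarrow> (\<exists>k. P n k)"
    unfolding hit using exists_least_iff [of "P n"] by blast
  moreover have "(THE k. hit k) = (LEAST k. P n k)" if "\<exists>k. P n k"
  proof (rule the_equality)
    show "hit (LEAST k. P n k)"
      unfolding hit using that by (auto intro: LeastI_ex dest: not_less_Least)
    show "k = (LEAST k. P n k)" if "hit k" for k
      using that unfolding hit by (metis LeastI not_less_Least linorder_neqE_nat)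
  qed
  ultimately show ?thesis
    unfolding eval.simps Let_def hit_def [symmetric] by auto
qed

lemma eval_search:
  assumes "decidable_in A (\<lambda>z. P (pair1 z) (pair2 z))"
  obtains p where "\<And>n. eval A p n = (if \<exists>k. P n k then Some (LEAST k. P n k) else None)"
proof -
  obtain p where "\<And>z. eval A p z = Some (of_bool (\<not> P (pair1 z) (pair2 z)))"
    using decidable_not [OF assms] by (auto simp: computable_in_def)
  from eval_Minim [of A p P, OF this] that show thesis by blast
qed

lemma computable_Least:
  assumes "decidable_in A (\<lambda>z. P (pair1 z) (pair2 z))" "\<And>n. \<exists>k. P n k"
  shows "computable_in A (\<lambda>n. LEAST k. P n k)"
  using eval_search [OF assms(1)] assms(2) unfolding computable_in_def by metis

lemma ce_in_projection:
  assumes "decidable_in A (\<lambda>z. P (pair1 z) (pair2 z))"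
  shows "ce_in A {n. \<exists>k. P n k}"
proof -
  obtain p where "\<And>n. eval A p n = (if \<exists>k. P n k then Some (LEAST k. P n k) else None)"
    using eval_search [OF assms] by blast
  then have "{n. \<exists>k. P n k} = dom (eval A p)" by (auto split: if_splits)
  then show ?thesis unfolding ce_in_def by blast
qed

text \<open>The disjunct \<open>b n \<le> k\<close> makes the search total. The value is
  \<open>b n\<close> when no witness lies below the bound, and bounded quantifiers are decided by
  testing for this.\<close>

lemma computable_bounded_Least [computable]:
  assumes "decidable_in A (\<lambda>z. P (pair1 z) (pair2 z))" "computable_in A b"
  shows "computable_in A (\<lambda>n. LEAST k. b n \<le> k \<or> P n k)"
proof (rule computable_Least)
  show "decidable_in A (\<lambda>z. b (pair1 z) \<le> pair2 z \<or> P (pair1 z) (pair2 z))"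
    by (intro computable assms computable_comp [OF assms(2)])
qed blast

lemma decidable_bounded_ex [computable]:
  assumes "decidable_in A (\<lambda>z. P (pair1 z) (pair2 z))" "computable_in A b"
  shows "decidable_in A (\<lambda>n. \<exists>k<b n. P n k)"
proof -
  have "(LEAST k. b n \<le> k \<or> P n k) < b n \<longleftrightarrow> (\<exists>k<b n. P n k)" for n
  proof
    assume "(LEAST k. b n \<le> k \<or> P n k) < b n"
    moreover have "b n \<le> (LEAST k. b n \<le> k \<or> P n k) \<or> P n (LEAST k. b n \<le> k \<or> P n k)"
      by (rule LeastI [of _ "b n"]) simp
    ultimately show "\<exists>k<b n. P n k" by auto
  next
    assume "\<exists>k<b n. P n k"
    then obtain k where k: "k < b n" "P n k" by blast
    then have "(LEAST k. b n \<le> k \<or> P n k) \<le> k" by (intro Least_le) simp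
    with k show "(LEAST k. b n \<le> k \<or> P n k) < b n" by simp
  qed
  moreover have "decidable_in A (\<lambda>n. (LEAST k. b n \<le> k \<or> P n k) < b n)"
    by (intro computable assms)
  ultimately show ?thesis by simp
qed

lemma decidable_bounded_all [computable]:
  assumes "decidable_in A (\<lambda>z. P (pair1 z) (pair2 z))" "computable_in A b"
  shows "decidable_in A (\<lambda>n. \<forall>k<b n. P n k)"
  using decidable_not [OF decidable_bounded_ex [OF decidable_not [OF assms(1)] assms(2)]]
  by (simp only: not_ex not_not de_Morgan_conj imp_conv_disj)

lemma computable_div [computable]:
  assumes "computable_in A f" "computable_in A g"
  shows "computable_in A (\<lambda>n. f n div g n)"
proof (rule computable_binary [OF _ assms])
  \<comment> \<open>For \<open>b = 0\<close> the search stops at once with 0, in accordance with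
    \<open>a div 0 = 0\<close>.\<close>
  have "(LEAST q. b = 0 \<or> a < Suc q * b) = a div b" for a b :: nat
  proof (rule Least_equality)
    show "b = 0 \<or> a < Suc (a div b) * b"
      using dividend_less_div_times [of b a] by (cases "b = 0") (auto simp: algebra_simps)
    show "a div b \<le> q" if "b = 0 \<or> a < Suc q * b" for q
    proof (cases "b = 0")
      case False
      with that have "a div b < Suc q" by (intro less_mult_imp_div_less) auto
      then show ?thesis by simp
    qed simp
  qed
  moreover have "computable_in A (\<lambda>z. LEAST q. pair2 z = 0 \<or> pair1 z < Suc q * pair2 z)"
  proof (rule computable_Least)
    show "\<exists>k. pair2 n = 0 \<or> pair1 n < Suc k * pair2 n" for n
      by (cases "pair2 n") (auto intro!: exI [of _ "pair1 n"])
  qed (intro computable)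
  ultimately show "computable_in A (\<lambda>z. pair1 z div pair2 z)" by simp
qed

lemma computable_mod [computable]:
  assumes "computable_in A f" "computable_in A g"
  shows "computable_in A (\<lambda>n. f n mod g n)"
  using computable_diff [OF assms(1) computable_mult [OF computable_div [OF assms] assms(2)]]
  by (simp add: minus_div_mult_eq_mod)

lemma decidable_set_decode [computable]:
  assumes "computable_in A f" "computable_in A g"
  shows "decidable_in A (\<lambda>n. f n \<in> set_decode (g n))"
proof -
  have "decidable_in A (\<lambda>n. f n \<in> set_decode (g n)) \<longleftrightarrow>
      decidable_in A (\<lambda>n. g n div 2 ^ f n mod 2 = 1)"
    by (simp add: set_decode_def odd_iff_mod_2_eq_one)
  moreover have "decidable_in A (\<lambda>n. g n div 2 ^ f n mod 2 = 1)"
    by (intro computable assms)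
  ultimately show ?thesis by simp
qed

lemma set_encode_less_power: "set_encode (X \<inter> {..<n}) < 2 ^ n"
proof (induction n)
  case (Suc n)
  have "X \<inter> {..<Suc n} = (if n \<in> X then insert n (X \<inter> {..<n}) else X \<inter> {..<n})"
    by (auto simp: less_Suc_eq)
  with Suc show ?case by (simp add: set_encode_insert)
qed simp

lemma computable_bounded_collect [computable]:
  assumes "decidable_in A (\<lambda>z. P (pair1 z) (pair2 z))" "computable_in A b"
  shows "computable_in A (\<lambda>n. set_encode {k. k < b n \<and> P n k})"
proof -
  have "set_encode {k. k < m \<and> P n k} = rec_nat 0 (\<lambda>k r. if P n k then 2 ^ k + r else r) m" for n m
  proof (induction m)
    case (Suc m)
    have "{k. k < Suc m \<and> P n k} = (if P n m then insert m {k. k < m \<and> P n k} else {k. k < m \<and> P n k})"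
      by (auto simp: less_Suc_eq)
    then show ?case using Suc by (simp add: set_encode_insert)
  qed simp
  moreover have "computable_in A (\<lambda>n. rec_nat 0 (\<lambda>k r. if P n k then 2 ^ k + r else r) (b n))"
    by (intro computable assms computable_binary [OF assms(1)])
  ultimately show ?thesis by simp
qed


section \<open>Strings as pairs of a length and a set code\<close>

text \<open>Every pair of numbers denotes a string, since bits of \<open>a\<close> from
  \<open>l\<close> on are ignored; a search over strings is thus a search over numbers without a
  validity test.\<close>

definition bits :: "nat \<Rightarrow> nat \<Rightarrow> bool list" where
  "bits l a = map (\<lambda>i. i \<in> set_decode a) [0..<l]"

lemma length_bits [simp]: "length (bits l a) = l"
  by (simp add: bits_def)

lemma nth_bits [simp]: "i < l \<Longrightarrow> bits l a ! i \<longleftrightarrow> i \<in> set_decode a"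
  by (simp add: bits_def)

lemma bits_surj: "\<exists>a. bits (length s) a = s"
proof
  show "bits (length s) (set_encode {i. i < length s \<and> s ! i}) = s"
    by (rule nth_equalityI) auto
qed

lemma bits_eq_initial_segment_iff:
  "bits l a = initial_segment X l \<longleftrightarrow> (\<forall>i<l. i \<in> set_decode a \<longleftrightarrow> i \<in> X)"
  by (auto simp: bits_def initial_segment_def)

lemma string_num_eq_iff [simp]: "string_num s = string_num t \<longleftrightarrow> s = t"
proof
  assume "string_num s = string_num t"
  then have "map of_bool s = (map of_bool t :: nat list)"
    by (simp add: string_num_def list_encode_eq)
  then show "s = t"
    by (rule map_injective) (auto simp: inj_def)
qed simp

lemma computable_string_num_bits [computable]:
  assumes "computable_in A f" "computable_in A g"
  shows "computable_in A (\<lambda>n. string_num (bits (f n) (g n)))"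
proof (rule computable_binary [OF _ assms])
  define step where "step l a k r = Suc (prod_encode (of_bool (l - Suc k \<in> set_decode a), r))" for l a k r
  \<comment> \<open>\<open>list_encode\<close> nests from the tail, so the recursion starts with the
    last bit; after \<open>k\<close> steps it has coded the last \<open>k\<close> bits.\<close>
  have "rec_nat 0 (step l a) k = list_encode (map of_bool (map (\<lambda>i. i \<in> set_decode a) [l - k..<l]))"
    if "k \<le> l" for l a k
    using that
  proof (induction k)
    case (Suc k)
    then have "[l - Suc k..<l] = (l - Suc k) # [l - k..<l]"
      by (simp add: upt_conv_Cons Suc_diff_Suc)
    with Suc show ?case by (simp add: step_def)
  qed simp
  from this [of l l for l] have "string_num (bits l a) = rec_nat 0 (step l a) l" for l a
    by (simp add: string_num_def bits_def)
  moreover have "computable_in A (\<lambda>z. rec_nat 0 (step (pair1 z) (pair2 z)) (pair1 z))"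
    unfolding step_def by (intro computable)
  ultimately show "computable_in A (\<lambda>z. string_num (bits (pair1 z) (pair2 z)))" by simp
qed


section \<open>Sets that are c.e. relative to the halting problem\<close>

primrec const_code :: "nat \<Rightarrow> code" where
  "const_code 0 = Zero"
| "const_code (Suc n) = Comp Succ (const_code n)"

lemma eval_const_code [simp]: "eval A (const_code c) n = Some c"
  by (induction c) auto

lemma computable_code_num_const_code [computable]:
  assumes "computable_in A f" shows "computable_in A (\<lambda>n. code_num (const_code (f n)))"
proof -
  have "code_num (const_code m) = rec_nat 0 (\<lambda>i r. 6 + 4 * prod_encode (1, r)) m" for m
    by (induction m) auto
  moreover have "computable_in A (\<lambda>n. rec_nat 0 (\<lambda>i r. 6 + 4 * prod_encode (1, r)) (f n))"
    by (intro computable assms)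
  ultimately show ?thesis by simp
qed

text \<open>The compound constructors are told apart by their residues modulo 4.\<close>

lemma code_tags:
  fixes a b :: nat
  shows "(5 + 4 * a = 5 + 4 * b) = (a = b)" "(5 + 4 * a = 6 + 4 * b) = False"
    "(5 + 4 * a = 7 + 4 * b) = False" "(5 + 4 * a = 8 + 4 * b) = False"
    "(6 + 4 * a = 5 + 4 * b) = False" "(6 + 4 * a = 6 + 4 * b) = (a = b)"
    "(6 + 4 * a = 7 + 4 * b) = False" "(6 + 4 * a = 8 + 4 * b) = False"
    "(7 + 4 * a = 5 + 4 * b) = False" "(7 + 4 * a = 6 + 4 * b) = False"
    "(7 + 4 * a = 7 + 4 * b) = (a = b)" "(7 + 4 * a = 8 + 4 * b) = False"
    "(8 + 4 * a = 5 + 4 * b) = False" "(8 + 4 * a = 6 + 4 * b) = False"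
    "(8 + 4 * a = 7 + 4 * b) = False" "(8 + 4 * a = 8 + 4 * b) = (a = b)"
  by presburger+

lemmas code_num_eq = code_num.simps code_tags prod_encode_eq prod.inject

lemma code_num_inject: "code_num p = code_num q \<Longrightarrow> p = q"
proof (induction p arbitrary: q)
  case (Pairing p1 p2)
  then show ?case by (cases q; simp only: code_num_eq code.inject; fastforce)
next
  case (Comp p1 p2)
  then show ?case by (cases q; simp only: code_num_eq code.inject; fastforce)
next
  case (PrimRec p1 p2)
  then show ?case by (cases q; simp only: code_num_eq code.inject; fastforce)
next
  case (Minim p)
  then show ?case by (cases q; simp only: code_num_eq code.inject; fastforce)
qed (case_tac q; simp)+

text \<open>One half of Post's theorem at level Sigma-2: the halting problem decides the inner
  universal quantifier, and the outer witness is searched for.\<close>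

lemma ce_in_jump:
  assumes "decidable_in {} (\<lambda>v. R (pair1 v) (pair2 v))"
  shows "ce_in (turing_jump {}) {x. \<exists>y. \<forall>z. R (prod_encode (x, y)) z}"
proof -
  obtain p where p: "\<And>w. eval {} p w = (if \<exists>z. \<not> R w z then Some (LEAST z. \<not> R w z) else None)"
    using eval_search [of "{}" "\<lambda>w z. \<not> R w z"] decidable_not [OF assms] by blast
  \<comment> \<open>The program numbered \<open>q w\<close> ignores its input and searches for a
    counterexample to \<open>R w\<close>. Whether it halts on its own number, which the jump
    records, is therefore a question about \<open>w\<close> alone.\<close>
  define q where "q w = 6 + 4 * prod_encode (code_num p, code_num (const_code w))" for w
  have "q w \<in> turing_jump {} \<longleftrightarrow> (\<exists>z. \<not> R w z)" for w
  proof -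
    have q: "q w = code_num (Comp p (const_code w))" by (simp add: q_def)
    have "q w \<in> turing_jump {} \<longleftrightarrow> eval {} (Comp p (const_code w)) (q w) \<noteq> None"
      unfolding turing_jump_def q by (blast dest: code_num_inject)
    then show ?thesis by (simp add: p)
  qed
  moreover have "decidable_in (turing_jump {}) (\<lambda>v. q (prod_encode (pair1 v, pair2 v)) \<notin> turing_jump {})"
    unfolding q_def by (intro decidable_not decidable_oracle computable)
  ultimately show ?thesis
    using ce_in_projection [of "turing_jump {}" "\<lambda>x y. \<forall>z. R (prod_encode (x, y)) z"] by simp
qed


section \<open>Uniform evaluation with finite oracles\<close>

text \<open>Here \<open>p\<close> may be partial. At most one \<open>k\<close> is a hit, since a hit
  excludes output 0 at all smaller arguments; this determines the value of
  \<open>THE\<close>.\<close>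

lemma eval_Minim_eq_Some_iff:
  "eval A (Minim p) n = Some k \<longleftrightarrow>
     eval A p (prod_encode (n, k)) = Some 0 \<and> (\<forall>i<k. \<exists>y>0. eval A p (prod_encode (n, i)) = Some y)"
proof -
  define hit where "hit = (\<lambda>k. eval A p (prod_encode (n, k)) = Some 0 \<and>
                     (\<forall>i<k. \<exists>y>0. eval A p (prod_encode (n, i)) = Some y))"
  have "k = k'" if "hit k" "hit k'" for k k'
    using that unfolding hit_def by (metis less_not_refl linorder_neqE_nat option.inject)
  then have "hit k \<Longrightarrow> (THE k. hit k) = k" for k by blast
  then have "(if \<exists>k. hit k then Some (THE k. hit k) else None) = Some k \<longleftrightarrow> hit k"
    by auto
  then show ?thesis
    unfolding eval.simps Let_def hit_def .
qed

abbreviation triple :: "nat \<Rightarrow> nat \<Rightarrow> nat \<Rightarrow> nat" where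
  "triple e x y \<equiv> prod_encode (e, prod_encode (x, y))"

text \<open>A triple \<open>e\<close>, \<open>x\<close>, \<open>y\<close> asserts that the program with number \<open>e\<close> returns \<open>y\<close> on input \<open>x\<close>.
  \<open>S\<close> codes a finite set of triples already derived; \<open>t\<close> is a string, and oracle queries beyond
  its length have no answer.\<close>

definition justified :: "nat \<Rightarrow> nat \<Rightarrow> nat \<Rightarrow> nat \<Rightarrow> nat \<Rightarrow> nat \<Rightarrow> bool" where
  "justified t k S e x y \<longleftrightarrow>
     e = 0 \<and> y = 0 \<or> e = 1 \<and> y = Suc x \<or> e = 2 \<and> y = pair1 x \<or> e = 3 \<and> y = pair2 x \<or>
     e = 4 \<and> x < pair1 t \<and> y = of_bool (x \<in> set_decode (pair2 t)) \<or>
     (\<exists>p<k. \<exists>q<k. e = 5 + 4 * prod_encode (p, q) \<and>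
        (\<exists>u<k. \<exists>w<k. triple p x u \<in> set_decode S \<and> triple q x w \<in> set_decode S \<and> y = prod_encode (u, w))) \<or>
     (\<exists>p<k. \<exists>q<k. e = 6 + 4 * prod_encode (p, q) \<and>
        (\<exists>w<k. triple q x w \<in> set_decode S \<and> triple p w y \<in> set_decode S)) \<or>
     (\<exists>p<k. \<exists>q<k. e = 7 + 4 * prod_encode (p, q) \<and>
        (pair2 x = 0 \<and> triple p (pair1 x) y \<in> set_decode S \<or>
         (\<exists>i<k. \<exists>r<k. pair2 x = Suc i \<and> triple e (prod_encode (pair1 x, i)) r \<in> set_decode S \<and>
            triple q (prod_encode (pair1 x, prod_encode (i, r))) y \<in> set_decode S))) \<or>
     (\<exists>p<k. e = 8 + 4 * p \<and> triple p (prod_encode (x, y)) 0 \<in> set_decode S \<and>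
        (\<forall>i<y. \<exists>z<k. 0 < z \<and> triple p (prod_encode (x, i)) z \<in> set_decode S))"

text \<open>One-step inference, iterated from the empty set. The iteration number bounds both the
  quantifiers in \<open>justified\<close> and the triples kept, so each set is finite and is found
  effectively.\<close>

definition derived :: "nat \<Rightarrow> nat \<Rightarrow> nat" where
  "derived t = rec_nat 0 (\<lambda>k S. set_encode {v. v < k \<and>
     justified t k S (pair1 v) (pair1 (pair2 v)) (pair2 (pair2 v))})"

definition halts_by :: "nat \<Rightarrow> nat \<Rightarrow> nat \<Rightarrow> nat \<Rightarrow> bool" where
  "halts_by t k e x \<longleftrightarrow> (\<exists>y<k. triple e x y \<in> set_decode (derived t k))"

definition agrees :: "nat \<Rightarrow> nat set \<Rightarrow> bool" where
  "agrees t A \<longleftrightarrow> (\<forall>i<pair1 t. i \<in> set_decode (pair2 t) \<longleftrightarrow> i \<in> A)"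

lemma derived_0 [simp]: "derived t 0 = 0"
  by (simp add: derived_def)

lemma triple_in_derived_Suc:
  "triple e x y \<in> set_decode (derived t (Suc k)) \<longleftrightarrow>
     triple e x y < k \<and> justified t k (derived t k) e x y"
  by (simp add: derived_def)

lemma decidable_justified [computable]:
  assumes "computable_in A a" "computable_in A b" "computable_in A c"
    "computable_in A d" "computable_in A e" "computable_in A f"
  shows "decidable_in A (\<lambda>n. justified (a n) (b n) (c n) (d n) (e n) (f n))"
proof -
  have *: "decidable_in A (\<lambda>z. justified (pair1 z) (pair1 (pair2 z)) (pair1 (pair2 (pair2 z)))
    (pair1 (pair2 (pair2 (pair2 z)))) (pair1 (pair2 (pair2 (pair2 (pair2 z)))))
    (pair2 (pair2 (pair2 (pair2 (pair2 z))))))"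
    unfolding justified_def by (intro computable)
  have "computable_in A (\<lambda>n. prod_encode (a n, prod_encode (b n, prod_encode (c n,
      prod_encode (d n, prod_encode (e n, f n))))))"
    by (intro computable assms)
  from computable_comp [OF * this] show ?thesis
    by (simp only: prod_encode_inverse fst_conv snd_conv)
qed

lemma computable_derived [computable]:
  assumes "computable_in A f" "computable_in A g"
  shows "computable_in A (\<lambda>n. derived (f n) (g n))"
proof (rule computable_binary [OF _ assms])
  show "computable_in A (\<lambda>z. derived (pair1 z) (pair2 z))"
    unfolding derived_def by (intro computable)
qed

lemma decidable_halts_by [computable]:
  assumes "computable_in A f" "computable_in A g" "computable_in A h" "computable_in A k"
  shows "decidable_in A (\<lambda>n. halts_by (f n) (g n) (h n) (k n))"
proof (rule computable_quaternary [OF _ assms, where F = "\<lambda>a b c d. of_bool (halts_by a b c d)"])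
  show "decidable_in A (\<lambda>z. halts_by (pair1 z) (pair1 (pair2 z)) (pair1 (pair2 (pair2 z)))
      (pair2 (pair2 (pair2 z))))"
    unfolding halts_by_def by (intro computable)
qed

text \<open>\<open>k\<close> bounds existential quantifiers only and \<open>S\<close> occurs only
  positively; the universal quantifier is bounded by \<open>y\<close>.\<close>

lemma justified_mono:
  assumes "justified t k S e x y" "k \<le> k'" "set_decode S \<subseteq> set_decode S'"
  shows "justified t k' S' e x y"
proof -
  have less: "u < k \<longrightarrow> u < k'" for u using assms(2) by auto
  have sub: "v \<in> set_decode S \<longrightarrow> v \<in> set_decode S'" for v using assms(3) by auto
  have "justified t k S e x y \<longrightarrow> justified t k' S' e x y"
    unfolding justified_def
    by (intro imp_refl less sub disj_mono conj_mono ex_mono all_mono imp_mono)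
  with assms(1) show ?thesis by blast
qed

lemma derived_mono: 
  assumes "k \<le> k'" shows "set_decode (derived t k) \<subseteq> set_decode (derived t k')"
proof -
  have "set_decode (derived t k) \<subseteq> set_decode (derived t (Suc k))" for k
  proof (induction k)
    case (Suc k)
    show ?case
    proof
      fix v assume v: "v \<in> set_decode (derived t (Suc k))"
      obtain e x y where "v = triple e x y"
        by (metis surj_pair prod_decode_inverse)
      with v Suc show "v \<in> set_decode (derived t (Suc (Suc k)))"
        by (auto simp: triple_in_derived_Suc intro: justified_mono)
    qed
  qed simp
  then show ?thesis using lift_Suc_mono_le [of "\<lambda>k. set_decode (derived t k)"] assms by blast
qed

lemma halts_by_mono: "halts_by t k e x \<Longrightarrow> k \<le> k' \<Longrightarrow> halts_by t k' e x"
  unfolding halts_by_def using derived_mono [of k k' t] by (meson less_le_trans subsetD)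

text \<open>The induction is on \<open>k\<close> and not on the program, because a premise for
  primitive recursion concerns the same program at a smaller argument.\<close>

lemma derived_sound:
  assumes "triple (code_num p) x y \<in> set_decode (derived t k)" "agrees t A"
  shows "eval A p x = Some y"
  using assms(1)
proof (induction k arbitrary: p x y)
  case (Suc k)
  note IH = Suc.IH
  have *: "justified t k (derived t k) (code_num p) x y"
    using Suc.prems by (simp add: triple_in_derived_Suc)
  show ?case
  proof (cases p)
    case (Pairing p1 p2)
    then have "\<exists>u w. triple (code_num p1) x u \<in> set_decode (derived t k) \<and>
        triple (code_num p2) x w \<in> set_decode (derived t k) \<and> y = prod_encode (u, w)"
      using * unfolding justified_def Pairing by (simp only: code_num_eq; fastforce)
    then show ?thesis using Pairing by (auto dest!: IH)
  next
    case (Comp p1 p2)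
    then have "\<exists>w. triple (code_num p2) x w \<in> set_decode (derived t k) \<and>
        triple (code_num p1) w y \<in> set_decode (derived t k)"
      using * unfolding justified_def Comp by (simp only: code_num_eq; fastforce)
    then show ?thesis using Comp by (auto dest!: IH)
  next
    case (PrimRec p1 p2)
    then have "pair2 x = 0 \<and> triple (code_num p1) (pair1 x) y \<in> set_decode (derived t k) \<or>
        (\<exists>i r. pair2 x = Suc i \<and> triple (code_num p) (prod_encode (pair1 x, i)) r \<in> set_decode (derived t k) \<and>
            triple (code_num p2) (prod_encode (pair1 x, prod_encode (i, r))) y \<in> set_decode (derived t k))"
      using * unfolding justified_def PrimRec by (simp only: code_num_eq; fastforce)
    then show ?thesis
    proof (elim disjE exE conjE)
      assume "pair2 x = 0" "triple (code_num p1) (pair1 x) y \<in> set_decode (derived t k)"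
      then show ?thesis using PrimRec IH by (simp add: case_prod_unfold)
    next
      fix i r
      assume i: "pair2 x = Suc i"
        and 1: "triple (code_num p) (prod_encode (pair1 x, i)) r \<in> set_decode (derived t k)"
        and 2: "triple (code_num p2) (prod_encode (pair1 x, prod_encode (i, r))) y \<in> set_decode (derived t k)"
      from IH [OF 1] IH [OF 2] i show ?thesis
        using PrimRec by (simp add: case_prod_unfold)
    qed
  next
    case (Minim p1)
    then have "triple (code_num p1) (prod_encode (x, y)) 0 \<in> set_decode (derived t k) \<and>
        (\<forall>i<y. \<exists>z. 0 < z \<and> triple (code_num p1) (prod_encode (x, i)) z \<in> set_decode (derived t k))"
      using * unfolding justified_def Minim by (simp only: code_num_eq; fastforce)
    then show ?thesis
      unfolding Minim eval_Minim_eq_Some_iff using IH by blast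
  next
    case Query
    then have "x < pair1 t \<and> y = of_bool (x \<in> set_decode (pair2 t))"
      using * unfolding justified_def by auto
    then show ?thesis using Query assms(2) by (simp add: agrees_def)
  qed (use * in \<open>auto simp: justified_def\<close>)
qed simp

text \<open>A computation uses finitely many triples and queries, and \<open>k \<le> pair1 t\<close>
  lets every \<open>t\<close> agreeing with \<open>A\<close> answer the queries below
  \<open>k\<close>. The threshold is thus uniform in \<open>t\<close>, so \<open>will_fire\<close>
  can fix \<open>k\<close> first and choose its string afterwards.\<close>

lemma derived_complete:
  assumes "eval A p x = Some y"
  shows "\<forall>\<^sub>F k in sequentially. \<forall>t. agrees t A \<and> k \<le> pair1 t \<longrightarrow>
           triple (code_num p) x y \<in> set_decode (derived t k)"
proof -
  define D where "D e x y \<longleftrightarrow> (\<forall>\<^sub>F k in sequentially. \<forall>t. agrees t A \<and> k \<le> pair1 t \<longrightarrow>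
      triple e x y \<in> set_decode (derived t k))" for e x y
  \<comment> \<open>A triple justified at \<open>k\<close> enters the next set once \<open>k\<close>
    exceeds it; the shift by one is invisible to "eventually".\<close>
  have step: "D e x y"
    if "\<forall>\<^sub>F k in sequentially. \<forall>t. agrees t A \<and> k \<le> pair1 t \<longrightarrow> justified t k (derived t k) e x y"
    for e x y
  proof -
    have "\<forall>\<^sub>F k in sequentially. \<forall>t. agrees t A \<and> Suc k \<le> pair1 t \<longrightarrow>
      triple e x y \<in> set_decode (derived t (Suc k))"
      using that eventually_gt_at_top [of "triple e x y"]
      by eventually_elim (auto simp: triple_in_derived_Suc)
    then show ?thesis unfolding D_def by (subst (asm) eventually_sequentially_Suc)
  qed
  have "D (code_num p) x y"
    using assms
  proof (induction p arbitrary: x y)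
    case Zero
    then show ?case by (intro step) (auto simp: justified_def)
  next
    case Succ
    then show ?case by (intro step) (auto simp: justified_def)
  next
    case Fst
    then show ?case by (intro step) (auto simp: justified_def)
  next
    case Snd
    then show ?case by (intro step) (auto simp: justified_def)
  next
    case Query
    show ?case
      by (intro step, rule eventually_mono [OF eventually_gt_at_top [of x]])
        (use Query in \<open>auto simp: justified_def agrees_def\<close>)
  next
    case (Pairing p q)
    then obtain u w where uw: "eval A p x = Some u" "eval A q x = Some w" "y = prod_encode (u, w)"
      by (auto simp: bind_eq_Some_conv)
    have "D (code_num p) x u" "D (code_num q) x w" using Pairing.IH uw by auto
    then have "D (code_num (Pairing p q)) x y"
      using eventually_gt_at_top [of "code_num p"] eventually_gt_at_top [of "code_num q"]
        eventually_gt_at_top [of u] eventually_gt_at_top [of w]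
      unfolding D_def [of "code_num p"] D_def [of "code_num q"]
      by (intro step, eventually_elim) (auto simp: justified_def uw)
    then show ?case .
  next
    case (Comp p q)
    then obtain w where w: "eval A q x = Some w" "eval A p w = Some y"
      by (auto simp: bind_eq_Some_conv)
    have "D (code_num q) x w" "D (code_num p) w y" using Comp.IH w by auto
    then show ?case
      using eventually_gt_at_top [of "code_num p"] eventually_gt_at_top [of "code_num q"]
        eventually_gt_at_top [of w]
      unfolding D_def [of "code_num p"] D_def [of "code_num q"]
      by (intro step, eventually_elim) (auto simp: justified_def)
  next
    case (PrimRec p q)
    obtain a m where x: "x = prod_encode (a, m)" by (metis prod_decode_inverse surj_pair)
    define rc where "rc = rec_nat (eval A p a)
       (\<lambda>i r. Option.bind r (\<lambda>y. eval A q (prod_encode (a, prod_encode (i, y)))))"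
    have "rc m = Some y" using PrimRec.prems by (simp add: x rc_def)
    then show ?case unfolding x
    proof (induction m arbitrary: y)
      case 0
      then have "D (code_num p) a y" using PrimRec.IH by (simp add: rc_def)
      then show ?case
        using eventually_gt_at_top [of "code_num p"] eventually_gt_at_top [of "code_num q"]
        unfolding D_def [of "code_num p"]
        by (intro step, eventually_elim) (auto simp: justified_def)
    next
      case (Suc m)
      then obtain r where r: "rc m = Some r" "eval A q (prod_encode (a, prod_encode (m, r))) = Some y"
        by (auto simp: bind_eq_Some_conv rc_def)
      have "D (code_num (PrimRec p q)) (prod_encode (a, m)) r"
        "D (code_num q) (prod_encode (a, prod_encode (m, r))) y"
        using Suc.IH r PrimRec.IH by auto
      then show ?case
        using eventually_gt_at_top [of "code_num p"] eventually_gt_at_top [of "code_num q"]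
          eventually_gt_at_top [of m] eventually_gt_at_top [of r]
        unfolding D_def [of _ "prod_encode (a, m)"] D_def [of "code_num q"]
        by (intro step, eventually_elim) (auto simp: justified_def)
    qed
  next
    case (Minim p)
    then have 0: "eval A p (prod_encode (x, y)) = Some 0"
      and "\<forall>i<y. \<exists>z>0. eval A p (prod_encode (x, i)) = Some z"
      unfolding eval_Minim_eq_Some_iff by auto
    then obtain z where z: "\<And>i. i < y \<Longrightarrow> 0 < z i \<and> eval A p (prod_encode (x, i)) = Some (z i)"
      by metis
    have 1: "D (code_num p) (prod_encode (x, y)) 0" using Minim.IH 0 by auto
    have "\<forall>\<^sub>F k in sequentially. \<forall>i\<in>{..<y}. z i < k \<and> (\<forall>t. agrees t A \<and> k \<le> pair1 t \<longrightarrow>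
      triple (code_num p) (prod_encode (x, i)) (z i) \<in> set_decode (derived t k))"
      using Minim.IH z
      by (intro eventually_ball_finite ballI eventually_conj eventually_gt_at_top)
        (auto simp: D_def)
    moreover have "\<forall>\<^sub>F k in sequentially. code_num p < k"
      by (rule eventually_gt_at_top)
    ultimately have "\<forall>\<^sub>F k in sequentially. \<forall>t. agrees t A \<and> k \<le> pair1 t \<longrightarrow>
      justified t k (derived t k) (code_num (Minim p)) x y"
      using 1 unfolding D_def [of "code_num p"]
    proof eventually_elim
      case (elim k)
      show ?case
      proof (intro allI impI)
        fix t assume t: "agrees t A \<and> k \<le> pair1 t"
        have "triple (code_num p) (prod_encode (x, y)) 0 \<in> set_decode (derived t k)"
          using elim(3) t by blast
        moreover have "\<exists>w<k. 0 < w \<and> triple (code_num p) (prod_encode (x, i)) w \<in> set_decode (derived t k)"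
          if "i < y" for i
          using elim(1) t z [OF that] that by blast
        ultimately show "justified t k (derived t k) (code_num (Minim p)) x y"
          unfolding justified_def code_num.simps using elim(2) by blast
      qed
    qed
    then show ?case by (rule step)
  qed
  then show ?thesis by (simp add: D_def)
qed

lemma halts_by_sound:
  assumes "halts_by t k (code_num p) x" "agrees t A"
  shows "x \<in> dom (eval A p)"
  using assms derived_sound unfolding halts_by_def by blast

lemma halts_by_complete:
  assumes "x \<in> dom (eval A p)"
  shows "\<forall>\<^sub>F k in sequentially. \<forall>t. agrees t A \<and> k \<le> pair1 t \<longrightarrow> halts_by t k (code_num p) x"
proof -
  obtain y where "eval A p x = Some y" using assms by blast
  from derived_complete [OF this] eventually_gt_at_top [of y] show ?thesis
    by eventually_elim (auto simp: halts_by_def)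
qed

section \<open>The construction\<close>

text \<open>A stage codes a requirement, a candidate for its next string, and a padding component that
  lets each candidate come up infinitely often.  The state of a requirement consists of the length
  at which its current attempt is made, the number of attempts that have succeeded since the last
  injury, and its current string.\<close>

definition stage_req :: "nat \<Rightarrow> nat" where "stage_req s = pair1 (pair1 s)"
definition stage_str :: "nat \<Rightarrow> nat" where "stage_str s = pair2 (pair1 s)"

abbreviation pos :: "nat \<Rightarrow> nat" where "pos v \<equiv> pair1 v"
abbreviation cnt :: "nat \<Rightarrow> nat" where "cnt v \<equiv> pair1 (pair2 v)"
abbreviation str :: "nat \<Rightarrow> nat" where "str v \<equiv> pair2 (pair2 v)"

definition extends :: "nat \<Rightarrow> nat \<Rightarrow> bool" where
  "extends t t' \<longleftrightarrow> pair1 t' \<le> pair1 t \<and>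
     (\<forall>i<pair1 t'. i \<in> set_decode (pair2 t) \<longleftrightarrow> i \<in> set_decode (pair2 t'))"

definition wins :: "nat \<Rightarrow> nat \<Rightarrow> nat \<Rightarrow> nat \<Rightarrow> bool" where
  "wins s n h b \<longleftrightarrow> (\<forall>i<n. i \<in> set_decode b \<longleftrightarrow> i \<in> set_decode h) \<and>
     (\<exists>m<s. n \<le> m \<and> halts_by (stage_str s) s (pair1 (stage_req s)) (string_num (bits m b)))"

text \<open>The numbers \<open>h < 2 ^ pos v\<close> run through all strings of length
  \<open>pos v\<close>, so a success serves every walk waiting at that length. The cap on
  \<open>cnt\<close> keeps injuries finite, and \<open>b < s\<close> keeps the test
  decidable.\<close>

definition fires :: "nat \<Rightarrow> nat \<Rightarrow> nat \<Rightarrow> bool" where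
  "fires c s v \<longleftrightarrow> cnt v < 2 ^ (stage_req s + c) \<and> extends (stage_str s) (str v) \<and>
     (\<forall>h<2 ^ pos v. \<exists>b<s. wins s (pos v) h b)"

text \<open>A walk that moves at stage \<open>s\<close> arrives at length \<open>Suc s\<close>,
  where the new attempts are placed; \<open>max j\<close> preserves \<open>j \<le> pos\<close>. An
  injury resets the counter but keeps the string, so strings only grow.\<close>

definition update :: "nat \<Rightarrow> nat \<Rightarrow> nat \<Rightarrow> nat" where
  "update s j v =
     (if stage_req s < j then triple (max j (Suc s)) 0 (str v)
      else if stage_req s = j then triple (Suc s) (Suc (cnt v)) (stage_str s)
      else v)"

text \<open>The states of all requirements depend only on which earlier stages fired, so this finite
  set, coded as one number, is all that the recursion \<open>history\<close> has to carry
  along.\<close>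

definition replay :: "nat \<Rightarrow> nat \<Rightarrow> nat \<Rightarrow> nat" where
  "replay j F = rec_nat (triple j 0 (pair2 j)) (\<lambda>u v. if u \<in> set_decode F then update u j v else v)"

definition history :: "nat \<Rightarrow> nat \<Rightarrow> nat" where
  "history c = rec_nat 0 (\<lambda>u F. if fires c u (replay (stage_req u) F u) then 2 ^ u + F else F)"

definition state :: "nat \<Rightarrow> nat \<Rightarrow> nat \<Rightarrow> nat" where
  "state c s j = replay j (history c s) s"

definition fired :: "nat \<Rightarrow> nat \<Rightarrow> bool" where
  "fired c s \<longleftrightarrow> fires c s (state c s (stage_req s))"

lemma set_decode_history: "set_decode (history c s) = {u. u < s \<and> fired c u}"
proof (induction s)
  case (Suc s)
  have "history c (Suc s) = (if fired c s then 2 ^ s + history c s else history c s)"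
    by (simp add: history_def fired_def state_def)
  with Suc show ?case
    by (auto simp: set_decode_plus_power_2 less_Suc_eq)
qed (simp add: history_def)

lemma replay_cong:
  "(\<And>u. u < s \<Longrightarrow> u \<in> set_decode F \<longleftrightarrow> u \<in> set_decode F') \<Longrightarrow> replay j F s = replay j F' s"
  unfolding replay_def by (induction s) auto

lemma state_0: "state c 0 j = triple j 0 (pair2 j)"
  by (simp add: state_def replay_def)

lemma state_Suc: "state c (Suc s) j = (if fired c s then update s j (state c s j) else state c s j)"
proof -
  have "replay j (history c (Suc s)) s = replay j (history c s) s"
    by (rule replay_cong) (simp add: set_decode_history)
  moreover have "s \<in> set_decode (history c (Suc s)) \<longleftrightarrow> fired c s"
    by (simp add: set_decode_history)
  ultimately show ?thesis
    by (simp add: state_def replay_def)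
qed

lemma state_unchanged:
  "\<not> (fired c s \<and> stage_req s \<le> j) \<Longrightarrow> state c (Suc s) j = state c s j"
  by (auto simp: state_Suc update_def)

section \<open>Computability of the construction\<close>

lemma computable_stage [computable]:
  assumes "computable_in A f"
  shows "computable_in A (\<lambda>n. stage_req (f n))" "computable_in A (\<lambda>n. stage_str (f n))"
  unfolding stage_req_def stage_str_def by (intro computable assms)+

lemma decidable_extends [computable]:
  assumes "computable_in A f" "computable_in A g"
  shows "decidable_in A (\<lambda>n. extends (f n) (g n))"
proof (rule computable_binary [OF _ assms, where F = "\<lambda>a b. of_bool (extends a b)"])
  have "decidable_in A (\<lambda>z. pair1 (pair2 z) \<le> pair1 (pair1 z) \<and>
     (\<forall>i<pair1 (pair2 z). (i \<in> set_decode (pair2 (pair1 z)) \<longrightarrow> i \<in> set_decode (pair2 (pair2 z))) \<and>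
      (i \<in> set_decode (pair2 (pair2 z)) \<longrightarrow> i \<in> set_decode (pair2 (pair1 z)))))"
    by (intro computable)
  then show "decidable_in A (\<lambda>z. extends (pair1 z) (pair2 z))"
    unfolding extends_def iff_conv_conj_imp .
qed

lemma decidable_wins [computable]:
  assumes "computable_in A f" "computable_in A g" "computable_in A h" "computable_in A k"
  shows "decidable_in A (\<lambda>n. wins (f n) (g n) (h n) (k n))"
proof (rule computable_quaternary [OF _ assms, where F = "\<lambda>a b c d. of_bool (wins a b c d)"])
  show "decidable_in A (\<lambda>z. wins (pair1 z) (pair1 (pair2 z)) (pair1 (pair2 (pair2 z)))
      (pair2 (pair2 (pair2 z))))"
    unfolding wins_def iff_conv_conj_imp by (intro computable)
qed

lemma decidable_fires [computable]:
  assumes "computable_in A f" "computable_in A g"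
  shows "decidable_in A (\<lambda>n. fires c (f n) (g n))"
proof (rule computable_binary [OF _ assms, where F = "\<lambda>a b. of_bool (fires c a b)"])
  show "decidable_in A (\<lambda>z. fires c (pair1 z) (pair2 z))"
    unfolding fires_def by (intro computable)
qed

lemma computable_update [computable]:
  assumes "computable_in A f" "computable_in A g" "computable_in A h"
  shows "computable_in A (\<lambda>n. update (f n) (g n) (h n))"
proof (rule computable_ternary [OF _ assms])
  show "computable_in A (\<lambda>z. update (pair1 z) (pair1 (pair2 z)) (pair2 (pair2 z)))"
    unfolding update_def by (intro computable)
qed

lemma computable_replay [computable]:
  assumes "computable_in A f" "computable_in A g" "computable_in A h"
  shows "computable_in A (\<lambda>n. replay (f n) (g n) (h n))"
proof (rule computable_ternary [OF _ assms])
  show "computable_in A (\<lambda>z. replay (pair1 z) (pair1 (pair2 z)) (pair2 (pair2 z)))"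
    unfolding replay_def by (intro computable)
qed

lemma computable_history [computable]:
  assumes "computable_in A f"
  shows "computable_in A (\<lambda>n. history c (f n))"
  unfolding history_def by (intro computable assms)

lemma computable_state [computable]:
  assumes "computable_in A f" "computable_in A g"
  shows "computable_in A (\<lambda>n. state c (f n) (g n))"
  unfolding state_def by (intro computable assms)

lemma decidable_fired [computable]:
  assumes "computable_in A f"
  shows "decidable_in A (\<lambda>n. fired c (f n))"
  unfolding fired_def by (intro computable assms)

section \<open>Finite injury and convergence of the states\<close>

lemma extends_refl: "extends t t"
  by (simp add: extends_def)

lemma extends_trans: "extends t t' \<Longrightarrow> extends t' t'' \<Longrightarrow> extends t t''"
  unfolding extends_def by (meson le_trans less_le_trans)

lemma agrees_extends: "extends t t' \<Longrightarrow> agrees t A \<Longrightarrow> agrees t' A"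
  unfolding extends_def agrees_def by (meson less_le_trans)

lemma str_state_mono:
  assumes "s \<le> s'" shows "extends (str (state c s' j)) (str (state c s j))"
  using assms
proof (induction s' rule: dec_induct)
  case (step s')
  have "extends (str (state c (Suc s') j)) (str (state c s' j))"
    by (auto simp: state_Suc update_def extends_refl fired_def fires_def)
  then show ?case using step.IH by (rule extends_trans)
qed (rule extends_refl)

text \<open>Ensures that the condition \<open>j \<le> n\<close> in \<open>waits\<close> excludes no
  requirement whose attempt has length \<open>n\<close>.\<close>

lemma le_pos_state: "j \<le> pos (state c s j)"
proof (induction s)
  case (Suc s)
  have "stage_req s \<le> s"
    unfolding stage_req_def
    by (metis le_prod_encode_1 le_trans prod.collapse prod_decode_inverse)
  with Suc show ?case by (auto simp: state_Suc update_def)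
qed (simp add: state_0)

lemma pos_state_le: "pos (state c s j) \<le> max j s"
  by (induction s) (auto simp: state_0 state_Suc update_def)

text \<open>Finite injury: once no requirement before \<open>j\<close> fires, the counter of
  \<open>j\<close> is never reset and each firing of \<open>j\<close> raises it, while
  \<open>fires\<close> caps it at \<open>2 ^ (j + c)\<close>.\<close>

lemma finitely_many_fired_below: "\<exists>r. \<forall>s\<ge>r. fired c s \<longrightarrow> j \<le> stage_req s"
proof (induction j)
  case (Suc j)
  then obtain r where r: "\<And>s. s \<ge> r \<Longrightarrow> fired c s \<Longrightarrow> j \<le> stage_req s" by blast
  have step: "cnt (state c (Suc s) j) = cnt (state c s j) + of_bool (fired c s \<and> stage_req s = j)"
    if "s \<ge> r" for s
    using r [OF that] by (auto simp: state_Suc update_def)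
  have mono: "cnt (state c s j) \<le> cnt (state c s' j)" if "s \<le> s'" "r \<le> s" for s s'
    using that by (induction s' rule: dec_induct) (auto simp: step)
  show ?case
  proof (rule ccontr)
    assume "\<not> ?thesis"
    then have inf: "\<exists>s\<ge>q. fired c s \<and> stage_req s < Suc j" for q
      by (meson not_le)
    have again: "\<exists>s\<ge>q. fired c s \<and> stage_req s = j" if "r \<le> q" for q
      using inf [of q] r that by (metis le_antisym le_trans less_Suc_eq_le)
    have "\<exists>s\<ge>r. m \<le> cnt (state c s j)" for m
    proof (induction m)
      case (Suc m)
      then obtain s where s: "s \<ge> r" "m \<le> cnt (state c s j)" by blast
      obtain s' where s': "s' \<ge> s" "fired c s'" "stage_req s' = j" using again [OF s(1)] by blast
      then have "Suc m \<le> cnt (state c (Suc s') j)"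
        using s mono [OF s'(1) s(1)] by (simp add: step)
      then show ?case using s s' by (meson le_SucI le_trans)
    qed auto
    then obtain s where s: "s \<ge> r" "2 ^ (j + c) \<le> cnt (state c s j)" by blast
    obtain s' where s': "s' \<ge> s" "fired c s'" "stage_req s' = j" using again [OF s(1)] by blast
    then have "cnt (state c s' j) < 2 ^ (j + c)" by (simp add: fired_def fires_def)
    with mono [OF s'(1) s(1)] s(2) show False by simp
  qed
qed simp

lemma state_constant:
  assumes "\<forall>u\<ge>r. fired c u \<longrightarrow> j < stage_req u" "r \<le> s"
  shows "state c s j = state c r j"
  using assms(2)
proof (induction s rule: dec_induct)
  case (step s)
  with assms(1) have "\<not> (fired c s \<and> stage_req s \<le> j)" by (meson not_le)
  with step show ?case by (simp add: state_unchanged)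
qed simp

lemma state_converges: obtains r v where "\<And>s. s \<ge> r \<Longrightarrow> state c s j = v"
proof -
  obtain r where "\<forall>s\<ge>r. fired c s \<longrightarrow> Suc j \<le> stage_req s"
    using finitely_many_fired_below by blast
  then have "\<forall>s\<ge>r. fired c s \<longrightarrow> j < stage_req s" by (simp only: Suc_le_eq)
  from state_constant [OF this] show thesis by (rule that)
qed

text \<open>The least stage after all injuries is either 0 or comes right after an injury; both
  leave the counter at 0.\<close>

lemma final_run:
  obtains r where "\<And>s. s \<ge> r \<Longrightarrow> fired c s \<Longrightarrow> j \<le> stage_req s" "cnt (state c r j) = 0"
proof -
  define r where "r = (LEAST r. \<forall>s\<ge>r. fired c s \<longrightarrow> j \<le> stage_req s)"
  have r: "\<forall>s\<ge>r. fired c s \<longrightarrow> j \<le> stage_req s"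
    unfolding r_def using finitely_many_fired_below by (rule LeastI_ex)
  have cnt: "cnt (state c r j) = 0"
  proof (cases r)
    case 0
    then show ?thesis by (simp add: state_0)
  next
    case (Suc q)
    have "\<not> (\<forall>s\<ge>q. fired c s \<longrightarrow> j \<le> stage_req s)"
      using Suc unfolding r_def by (intro not_less_Least) simp
    with r have "fired c q" "stage_req q < j"
      unfolding Suc by (metis le_antisym not_less_eq_eq not_le)+
    then show ?thesis by (simp add: Suc state_Suc update_def)
  qed
  show thesis
    by (rule that [OF _ cnt]) (use r in blast)
qed

text \<open>A discrete intermediate value argument: the counter starts at 0 and rises by single
  steps, so it leaves the value \<open>k\<close> at a stage where \<open>j\<close> fires.\<close>

lemma counter_crossing:
  assumes r: "\<And>s. s \<ge> r \<Longrightarrow> fired c s \<Longrightarrow> j \<le> stage_req s" "cnt (state c r j) = 0"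
    and large: "\<And>s. s \<ge> q \<Longrightarrow> k < cnt (state c s j)"
  obtains s where "s \<ge> r" "fired c s" "stage_req s = j" "cnt (state c s j) = k"
proof -
  define s where "s = (LEAST s. s \<ge> r \<and> k < cnt (state c (Suc s) j))"
  have s: "s \<ge> r \<and> k < cnt (state c (Suc s) j)"
    unfolding s_def
  proof (rule LeastI)
    show "max q r \<ge> r \<and> k < cnt (state c (Suc (max q r)) j)"
      by (intro conjI large) simp_all
  qed
  have le: "cnt (state c s j) \<le> k"
  proof (cases "s = r")
    case True
    then show ?thesis using r(2) by simp
  next
    case False
    define u where "u = s - 1"
    have u: "s = Suc u" "r \<le> u" using False s unfolding u_def by linarith+
    have "\<not> (u \<ge> r \<and> k < cnt (state c (Suc u) j))"
      by (rule not_less_Least) (fold s_def, simp add: u(1))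
    with u show ?thesis by simp
  qed
  with s have "state c (Suc s) j \<noteq> state c s j" by auto
  then have f: "fired c s" "stage_req s \<le> j" using state_unchanged by blast+
  then have "stage_req s = j" using r(1) s by (simp add: le_antisym)
  moreover from this f s le have "cnt (state c s j) = k"
    by (simp add: state_Suc update_def)
  ultimately show thesis using that f s by blast
qed

text \<open>By density each of the finitely many strings of length \<open>pos v\<close> has an
  extension in \<open>D\<close>. The computations enumerating these extensions share a bound
  \<open>k\<close> on their use of \<open>A\<close>, so the initial segment of \<open>A\<close> of
  length \<open>k\<close> is a suitable candidate.\<close>

lemma will_fire:
  fixes p \<sigma> c
  defines "j \<equiv> prod_encode (code_num p, \<sigma>)"
  assumes D: "string_num ` D = dom (eval A p)" "dense_strings D"
    and v: "agrees (str v) A" "cnt v < 2 ^ (j + c)"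
  obtains s where "s \<ge> r" "stage_req s = j" "fires c s v"
proof -
  define n where "n = pos v"
  have "\<exists>m b. n \<le> m \<and> (\<forall>i<n. i \<in> set_decode b \<longleftrightarrow> i \<in> set_decode h) \<and>
      string_num (bits m b) \<in> dom (eval A p)" for h
  proof -
    obtain t where t: "t \<in> D" "prefix (bits n h) t" using D(2) unfolding dense_strings_def by blast
    obtain b where b: "bits (length t) b = t" using bits_surj by blast
    obtain u where u: "t = bits n h @ u" using t(2) by (auto simp: prefix_def)
    then have "n \<le> length t" by simp
    moreover have "i \<in> set_decode b \<longleftrightarrow> i \<in> set_decode h" if "i < n" for i
    proof -
      have "bits (length t) b ! i \<longleftrightarrow> bits n h ! i" unfolding b using u that by (simp add: nth_append)
      then show ?thesis using that \<open>n \<le> length t\<close> by simp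
    qed
    moreover have "string_num (bits (length t) b) \<in> dom (eval A p)"
      using t(1) D(1) unfolding b by blast
    ultimately show ?thesis by blast
  qed
  then obtain m b where mb: "\<And>h. n \<le> m h" "\<And>h i. i < n \<Longrightarrow> i \<in> set_decode (b h) \<longleftrightarrow> i \<in> set_decode h"
    "\<And>h. string_num (bits (m h) (b h)) \<in> dom (eval A p)"
    by metis
  have "\<forall>\<^sub>F k in sequentially. pair1 (str v) \<le> k \<and> (\<forall>h\<in>{..<2 ^ n}. m h < k \<and> b h < k \<and>
      (\<forall>t. agrees t A \<and> k \<le> pair1 t \<longrightarrow> halts_by t k (code_num p) (string_num (bits (m h) (b h)))))"
    by (intro eventually_conj eventually_ge_at_top eventually_ball_finite ballI
        eventually_gt_at_top halts_by_complete mb finite_lessThan)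
  then obtain k where k: "pair1 (str v) \<le> k" "\<And>h. h < 2 ^ n \<Longrightarrow> m h < k \<and> b h < k \<and>
      (\<forall>t. agrees t A \<and> k \<le> pair1 t \<longrightarrow> halts_by t k (code_num p) (string_num (bits (m h) (b h))))"
    unfolding eventually_sequentially by (metis order_refl lessThan_iff)
  define t where "t = prod_encode (k, set_encode (A \<inter> {..<k}))"
  have t: "agrees t A" "pair1 t = k" by (auto simp: t_def agrees_def)
  have ext: "extends t (str v)"
    using v(1) k(1) by (auto simp: t_def extends_def agrees_def)
  \<comment> \<open>The padding pushes the stage past \<open>r\<close> and past \<open>k\<close>,
    which bounds all the searches in \<open>fires\<close>.\<close>
  define s where "s = prod_encode (prod_encode (j, t), r + k)"
  have s: "stage_req s = j" "stage_str s = t" by (simp_all add: s_def stage_req_def stage_str_def)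
  have "r + k \<le> s" unfolding s_def by (rule le_prod_encode_2)
  have "fires c s v"
    unfolding fires_def s n_def [symmetric]
  proof (intro conjI allI impI v ext)
    fix h :: nat assume "h < 2 ^ n"
    note kh = k(2) [OF this]
    have "halts_by t k (code_num p) (string_num (bits (m h) (b h)))" using kh t by simp
    then have "halts_by t s (code_num p) (string_num (bits (m h) (b h)))"
      by (rule halts_by_mono) (use \<open>r + k \<le> s\<close> in simp)
    moreover have "m h < s" "b h < s" using kh \<open>r + k \<le> s\<close> by auto
    ultimately show "\<exists>b<s. wins s n h b"
      unfolding wins_def s using mb(1,2) by (auto simp: j_def)
  qed
  show thesis
    by (rule that [OF _ s(1) \<open>fires c s v\<close>]) (use \<open>r + k \<le> s\<close> in simp)
qed

text \<open>Below the cap, \<open>will_fire\<close> would provide one more firing and so change the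
  final state.\<close>

lemma counter_exhausted:
  fixes p \<sigma> c
  defines "j \<equiv> prod_encode (code_num p, \<sigma>)"
  assumes D: "string_num ` D = dom (eval A p)" "dense_strings D"
    and v: "\<And>s. s \<ge> r \<Longrightarrow> state c s j = v" "agrees (str v) A"
  shows "2 ^ (j + c) \<le> cnt v"
proof (rule ccontr)
  assume "\<not> ?thesis"
  then obtain s where s: "s \<ge> r" "stage_req s = j" "fires c s v"
    using will_fire [OF D v(2)] unfolding j_def by (metis not_le)
  then have "fired c s" using v(1) by (simp add: fired_def)
  with s have "cnt (state c (Suc s) j) = Suc (cnt (state c s j))"
    by (simp add: state_Suc update_def)
  with v(1) s show False by simp
qed


section \<open>The random walk through the construction\<close>

text \<open>The value is below \<open>2 ^ m\<close>, and for random \<open>B\<close> each value has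
  probability \<open>(1/2) ^ m\<close>; the measure estimate rests on this.\<close>

definition attempt :: "nat set \<Rightarrow> nat \<Rightarrow> nat" where
  "attempt B m = set_encode (B \<inter> {..<m})"

definition waits :: "nat \<Rightarrow> nat set \<Rightarrow> nat \<Rightarrow> nat \<Rightarrow> nat \<Rightarrow> bool" where
  "waits c B s n j \<longleftrightarrow> j \<le> n \<and> pos (state c s j) = n \<and> cnt (state c s j) = attempt B (j + c)"

text \<open>Equal to \<open>Suc n\<close> if the walk waits for no requirement.\<close>

definition awaited :: "nat \<Rightarrow> nat set \<Rightarrow> nat \<Rightarrow> nat \<Rightarrow> nat" where
  "awaited c B s n = (LEAST j. Suc n \<le> j \<or> waits c B s n j)"

text \<open>A position \<open>g\<close> of the walk is a pair of a length \<open>n\<close> and a set code, of which only the bits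
  below \<open>n\<close> are final; raising \<open>n\<close> commits further bits.\<close>

definition advance :: "nat \<Rightarrow> nat set \<Rightarrow> nat \<Rightarrow> nat \<Rightarrow> nat" where
  "advance c B s g =
     (if Suc (pair1 g) \<le> awaited c B s (pair1 g) then prod_encode (Suc s, pair2 g)
      else if fired c s \<and> stage_req s = awaited c B s (pair1 g)
        then prod_encode (Suc s, LEAST b. s \<le> b \<or> wins s (pair1 g) (pair2 g) b)
      else if fired c s \<and> stage_req s < awaited c B s (pair1 g) then prod_encode (Suc s, pair2 g)
      else g)"

definition walk :: "nat \<Rightarrow> nat set \<Rightarrow> nat \<Rightarrow> nat" where
  "walk c B = rec_nat (prod_encode (0, 0)) (\<lambda>s g. advance c B s g)"

definition walk_total :: "nat \<Rightarrow> nat set \<Rightarrow> bool" where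
  "walk_total c B \<longleftrightarrow> (\<forall>x. \<exists>s. x < pair1 (walk c B s))"

definition walk_set :: "nat \<Rightarrow> nat set \<Rightarrow> nat set" where
  "walk_set c B = {x. x \<in> set_decode (pair2 (walk c B (LEAST s. x < pair1 (walk c B s))))}"

section \<open>Computability of the walk\<close>

lemma computable_attempt [computable]:
  assumes "computable_in B f"
  shows "computable_in B (\<lambda>n. attempt B (f n))"
proof -
  have "attempt B m = set_encode {k. k < m \<and> k \<in> B}" for m
    unfolding attempt_def by (rule arg_cong [where f = set_encode]) auto
  moreover have "computable_in B (\<lambda>n. set_encode {k. k < f n \<and> k \<in> B})"
    by (intro computable assms decidable_oracle)
  ultimately show ?thesis by simp
qed

lemma decidable_waits [computable]:
  assumes "computable_in B f" "computable_in B g" "computable_in B h"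
  shows "decidable_in B (\<lambda>n. waits c B (f n) (g n) (h n))"
  unfolding waits_def by (intro computable assms)

lemma computable_awaited [computable]:
  assumes "computable_in B f" "computable_in B g"
  shows "computable_in B (\<lambda>n. awaited c B (f n) (g n))"
proof (rule computable_binary [OF _ assms])
  show "computable_in B (\<lambda>z. awaited c B (pair1 z) (pair2 z))"
    unfolding awaited_def by (intro computable)
qed

lemma computable_advance [computable]:
  assumes "computable_in B f" "computable_in B g"
  shows "computable_in B (\<lambda>n. advance c B (f n) (g n))"
proof (rule computable_binary [OF _ assms])
  show "computable_in B (\<lambda>z. advance c B (pair1 z) (pair2 z))"
    unfolding advance_def by (intro computable)
qed

lemma computable_walk [computable]:
  assumes "computable_in B f"
  shows "computable_in B (\<lambda>n. walk c B (f n))"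
  unfolding walk_def by (intro computable assms)

lemma walk_set_reducible:
  assumes "walk_total c B" shows "walk_set c B \<le>\<^sub>T B"
proof -
  have "computable_in B (\<lambda>x. LEAST s. x < pair1 (walk c B s))"
    by (rule computable_Least) (intro computable, use assms in \<open>auto simp: walk_total_def\<close>)
  then have "decidable_in B (\<lambda>x. x \<in> set_decode (pair2 (walk c B (LEAST s. x < pair1 (walk c B s)))))"
    by (intro computable)
  then show ?thesis by (simp add: turing_reducible_iff walk_set_def)
qed

lemma walk_0: "walk c B 0 = prod_encode (0, 0)"
  by (simp add: walk_def)

lemma walk_Suc: "walk c B (Suc s) = advance c B s (walk c B s)"
  by (simp add: walk_def)

abbreviation walk_pos :: "nat \<Rightarrow> nat set \<Rightarrow> nat \<Rightarrow> nat" where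
  "walk_pos c B s \<equiv> pair1 (walk c B s)"

section \<open>The requirement that the walk waits for\<close>

lemma waits_awaited:
  assumes "awaited c B s n \<le> n" shows "waits c B s n (awaited c B s n)"
proof -
  have "Suc n \<le> awaited c B s n \<or> waits c B s n (awaited c B s n)"
    unfolding awaited_def by (rule LeastI [of _ "Suc n"]) simp
  with assms show ?thesis by simp
qed

lemma awaited_le: "waits c B s n j \<Longrightarrow> awaited c B s n \<le> j"
  unfolding awaited_def by (rule Least_le) simp

text \<open>States of requirements up to the awaited one change only if one of these requirements
  fires, so the least waiting one stays the same.\<close>

lemma awaited_persists:
  assumes a: "awaited c B s n \<le> n" and nf: "\<not> (fired c s \<and> stage_req s \<le> awaited c B s n)"
  shows "awaited c B (Suc s) n = awaited c B s n"
proof -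
  have same: "waits c B (Suc s) n j \<longleftrightarrow> waits c B s n j" if "j \<le> awaited c B s n" for j
    using nf that unfolding waits_def by (subst (1 2) state_unchanged) auto
  have le: "awaited c B (Suc s) n \<le> awaited c B s n"
    using waits_awaited [OF a] same by (intro awaited_le) simp
  moreover from this a have "waits c B (Suc s) n (awaited c B (Suc s) n)"
    by (intro waits_awaited) simp
  with le have "awaited c B s n \<le> awaited c B (Suc s) n"
    using same by (intro awaited_le) simp
  ultimately show ?thesis by simp
qed

lemma walk_stays:
  assumes "awaited c B s (walk_pos c B s) \<le> walk_pos c B s"
    "\<not> (fired c s \<and> stage_req s \<le> awaited c B s (walk_pos c B s))"
  shows "walk c B (Suc s) = walk c B s"
  using assms by (auto simp: walk_Suc advance_def)

lemma walk_moves: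
  assumes "\<not> (awaited c B s (walk_pos c B s) \<le> walk_pos c B s) \<or>
    fired c s \<and> stage_req s \<le> awaited c B s (walk_pos c B s)"
  shows "walk_pos c B (Suc s) = Suc s"
  using assms by (auto simp: walk_Suc advance_def)

text \<open>Each move brings the walk level with the stage number, so it falls behind only by
  waiting. When it begins to wait at length \<open>n\<close>, all relevant attempts have length at
  most \<open>n\<close> by \<open>pos_state_le\<close>, and their states do not change while it
  stays.\<close>

lemma walk_invariant:
  "walk_pos c B s \<le> s \<and> (walk_pos c B s < s \<longrightarrow>
     awaited c B s (walk_pos c B s) \<le> walk_pos c B s \<and>
     (\<forall>j\<le>awaited c B s (walk_pos c B s). pos (state c s j) \<le> walk_pos c B s))"
proof (induction s)
  case (Suc s)
  let ?n = "walk_pos c B s"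
  let ?a = "awaited c B s ?n"
  show ?case
  proof (cases "?a \<le> ?n \<and> \<not> (fired c s \<and> stage_req s \<le> ?a)")
    case True
    then have stay: "walk c B (Suc s) = walk c B s" "awaited c B (Suc s) ?n = ?a"
      by (simp_all add: walk_stays awaited_persists)
    have "pos (state c (Suc s) j) \<le> ?n" if "j \<le> ?a" for j
    proof -
      have "state c (Suc s) j = state c s j"
        using True that by (intro state_unchanged) auto
      moreover have "pos (state c s j) \<le> ?n"
      proof (cases "?n < s")
        case False
        with Suc have "?n = s" by simp
        then show ?thesis using pos_state_le [of c s j] True that by simp
      qed (use Suc that in blast)
      ultimately show ?thesis by simp
    qed
    then show ?thesis using True Suc stay by auto
  next
    case False
    then have "walk_pos c B (Suc s) = Suc s" by (intro walk_moves) blast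
    then show ?thesis by simp
  qed
qed (simp add: walk_0)

lemma walk_pos_le: "walk_pos c B s \<le> s"
  using walk_invariant by blast

text \<open>The walk cannot overtake the attempt chosen by \<open>B\<close>: at its length the walk
  waits for \<open>j\<close> or for a requirement before \<open>j\<close>, and a firing among these
  moves the attempt ahead as well.\<close>

lemma walk_pos_le_pos_state:
  "cnt (state c s j) = attempt B (j + c) \<Longrightarrow> walk_pos c B s \<le> pos (state c s j)"
proof (induction s)
  case (Suc s)
  let ?n = "walk_pos c B s"
  let ?a = "awaited c B s ?n"
  show ?case
  proof (cases "fired c s \<and> stage_req s \<le> j")
    case True
    then have "Suc s \<le> pos (state c (Suc s) j)" by (auto simp: state_Suc update_def)
    then show ?thesis using walk_pos_le [of c B "Suc s"] by simp
  next
    case False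
    then have same: "state c (Suc s) j = state c s j" by (rule state_unchanged)
    with Suc have le: "?n \<le> pos (state c s j)" by simp
    have w: "?a \<le> j" if "pos (state c s j) = ?n"
      using that Suc.prems same le_pos_state [of j c s] by (intro awaited_le) (simp add: waits_def)
    consider (stay) "?a \<le> ?n" "\<not> (fired c s \<and> stage_req s \<le> ?a)" | (free) "\<not> ?a \<le> ?n"
      | (act) "?a \<le> ?n" "fired c s" "stage_req s \<le> ?a"
      by blast
    then show ?thesis
    proof cases
      case stay
      then show ?thesis using le same by (simp add: walk_stays)
    next
      case free
      then have "walk_pos c B (Suc s) = Suc s" by (intro walk_moves) simp
      moreover have "?n = s" using free walk_invariant [of c B s] by linarith
      moreover have "pos (state c s j) \<noteq> ?n" using w free le_pos_state [of j c s] by fastforce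
      ultimately show ?thesis using le same by simp
    next
      \<comment> \<open>The firing requirement comes after \<open>j\<close>, hence so does the
        awaited one. The invariant then forces \<open>pos (state c s j) = ?n\<close>, but there a
        requirement no later than \<open>j\<close> would be awaited.\<close>
      case act
      with False have "j < ?a" by simp
      then have "pos (state c s j) \<le> ?n"
        using walk_invariant [of c B s] pos_state_le [of c s j] act(1)
        by (cases "?n < s") auto
      with le w \<open>j < ?a\<close> show ?thesis by simp
    qed
  qed
qed (simp add: walk_0)

section \<open>Stuck walks and walks that arrive\<close>

lemma walk_stuck:
  assumes a: "awaited c B s (walk_pos c B s) \<le> walk_pos c B s"
    and nf: "\<And>u. u \<ge> s \<Longrightarrow> \<not> (fired c u \<and> stage_req u \<le> awaited c B s (walk_pos c B s))"
    and "s \<le> u"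
  shows "walk c B u = walk c B s \<and> awaited c B u (walk_pos c B s) = awaited c B s (walk_pos c B s)"
  using assms(3)
proof (induction u rule: dec_induct)
  case (step u)
  then have eq: "walk c B u = walk c B s"
    "awaited c B u (walk_pos c B s) = awaited c B s (walk_pos c B s)" by simp_all
  have "walk c B (Suc u) = walk c B u"
    by (rule walk_stays) (use a nf [OF step(1)] in \<open>simp_all add: eq\<close>)
  moreover have "awaited c B (Suc u) (walk_pos c B s) = awaited c B u (walk_pos c B s)"
    by (rule awaited_persists) (use a nf [OF step(1)] in \<open>simp_all add: eq\<close>)
  ultimately show ?case by (simp add: eq)
qed simp

lemma stuck_not_walk_total:
  assumes "awaited c B s (walk_pos c B s) \<le> walk_pos c B s"
    "\<And>u. u \<ge> s \<Longrightarrow> \<not> (fired c u \<and> stage_req u \<le> awaited c B s (walk_pos c B s))"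
  shows "\<not> walk_total c B"
proof -
  have "walk_pos c B u \<le> s" for u
  proof (cases "s \<le> u")
    case True
    then show ?thesis using walk_stuck [OF assms True] walk_pos_le [of c B s] by simp
  next
    case False
    then show ?thesis using walk_pos_le [of c B u] by simp
  qed
  then show ?thesis unfolding walk_total_def by (meson not_le)
qed

text \<open>A move leads to the current stage number, so a bounded walk eventually stops moving. The
  requirement it then awaits keeps its counter at the value chosen by \<open>B\<close>.\<close>

lemma not_walk_total_attempt:
  assumes "\<not> walk_total c B"
  obtains j r where "\<And>s. s \<ge> r \<Longrightarrow> cnt (state c s j) = attempt B (j + c)"
proof -
  obtain x where x: "\<And>s. walk_pos c B s \<le> x" using assms unfolding walk_total_def by (meson not_le)
  have stay: "awaited c B s (walk_pos c B s) \<le> walk_pos c B s \<and>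
      \<not> (fired c s \<and> stage_req s \<le> awaited c B s (walk_pos c B s))" if "x \<le> s" for s
    using walk_moves [of c B s] x [of "Suc s"] that by linarith
  define n where "n = walk_pos c B x"
  have eq: "walk_pos c B s = n \<and> awaited c B s n = awaited c B x n" if "x \<le> s" for s
    using that
  proof (induction s rule: dec_induct)
    case (step s)
    with stay [OF step(1)] show ?case by (simp add: walk_stays awaited_persists)
  qed (simp add: n_def)
  have "cnt (state c s (awaited c B x n)) = attempt B (awaited c B x n + c)" if "x \<le> s" for s
    using waits_awaited [of c B s n] stay [OF that] eq [OF that] by (simp add: waits_def)
  then show thesis by (rule that)
qed

text \<open>A total walk cannot be waiting for a requirement before \<open>j\<close>, as none of
  them fires any more. It is not past the attempt for \<open>j\<close>, and the invariant shows that
  it is not short of it either.\<close>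

lemma walk_reaches_attempt:
  assumes "walk_total c B" and j: "stage_req s = j" "cnt (state c s j) = attempt B (j + c)"
    and final: "\<And>u. u \<ge> s \<Longrightarrow> fired c u \<Longrightarrow> j \<le> stage_req u"
  shows "awaited c B s (walk_pos c B s) = j" "pos (state c s j) = walk_pos c B s"
proof -
  let ?n = "walk_pos c B s"
  let ?a = "awaited c B s ?n"
  have a: "\<not> ?a < j" if "?a \<le> ?n"
    using stuck_not_walk_total [OF that] final assms(1) by (meson le_trans not_le)
  have "?n \<le> pos (state c s j)" using j(2) by (rule walk_pos_le_pos_state)
  moreover have "\<not> ?n < pos (state c s j)"
  proof
    assume less: "?n < pos (state c s j)"
    show False
    proof (cases "?n < s")
      case True
      then have le: "?a \<le> ?n" and pos: "\<forall>j\<le>?a. pos (state c s j) \<le> ?n"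
        using walk_invariant [of c B s] by auto
      have "j \<le> ?a" using a [OF le] by simp
      with pos less show False by (meson not_le)
    next
      case False
      have "j \<le> s"
        unfolding j(1) [symmetric] stage_req_def
        by (metis le_prod_encode_1 le_trans prod.collapse prod_decode_inverse)
      then show False using less False walk_pos_le [of c B s] pos_state_le [of c s j] by simp
    qed
  qed
  ultimately show *: "pos (state c s j) = ?n" by simp
  then have "waits c B s ?n j" using j(2) le_pos_state [of j c s] by (simp add: waits_def)
  then have "?a \<le> j" "j \<le> ?n" by (auto simp: awaited_le waits_def)
  with a show "?a = j" by simp
qed

section \<open>The set computed by the walk\<close>

lemma walk_acts:
  assumes a: "awaited c B s (walk_pos c B s) = stage_req s" "stage_req s \<le> walk_pos c B s"
    and f: "fired c s"
  shows "wins s (walk_pos c B s) (pair2 (walk c B s)) (pair2 (walk c B (Suc s)))"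
    and "walk_pos c B (Suc s) = Suc s"
proof -
  let ?n = "walk_pos c B s" and ?h = "pair2 (walk c B s)"
  have next_walk: "walk c B (Suc s) = prod_encode (Suc s, LEAST b. s \<le> b \<or> wins s ?n ?h b)"
    using a f by (simp add: walk_Suc advance_def)
  then show "walk_pos c B (Suc s) = Suc s" by simp
  have "pos (state c s (stage_req s)) = ?n"
    using waits_awaited [of c B s ?n] a by (simp add: waits_def)
  \<comment> \<open>\<open>fires\<close> speaks about \<open>h < 2 ^ ?n\<close>, so it is applied to
    the code cut down to the committed bits. The witness below \<open>s\<close> also shows that the
    \<open>LEAST\<close> does not fall back on its default \<open>s\<close>.\<close>
  then obtain b where b: "b < s" "wins s ?n (set_encode (set_decode ?h \<inter> {..<?n})) b"
    using f set_encode_less_power unfolding fired_def fires_def by metis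
  then have "wins s ?n ?h b" by (auto simp: wins_def)
  then have "s \<le> (LEAST b. s \<le> b \<or> wins s ?n ?h b) \<or> wins s ?n ?h (LEAST b. s \<le> b \<or> wins s ?n ?h b)"
    by (intro LeastI [of "\<lambda>b. s \<le> b \<or> wins s ?n ?h b" b]) simp
  moreover have "(LEAST b. s \<le> b \<or> wins s ?n ?h b) \<le> b"
    using \<open>wins s ?n ?h b\<close> by (intro Least_le) simp
  ultimately show "wins s ?n ?h (pair2 (walk c B (Suc s)))"
    using b(1) by (simp add: next_walk)
qed

lemma walk_coherent:
  assumes "s \<le> u"
  shows "walk_pos c B s \<le> walk_pos c B u \<and> (\<forall>i<walk_pos c B s.
    i \<in> set_decode (pair2 (walk c B u)) \<longleftrightarrow> i \<in> set_decode (pair2 (walk c B s)))"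
  using assms
proof (induction u rule: dec_induct)
  case (step u)
  have "walk_pos c B u \<le> walk_pos c B (Suc u) \<and> (\<forall>i<walk_pos c B u.
    i \<in> set_decode (pair2 (walk c B (Suc u))) \<longleftrightarrow> i \<in> set_decode (pair2 (walk c B u)))"
  proof (cases "awaited c B u (walk_pos c B u) \<le> walk_pos c B u \<and> fired c u \<and>
      stage_req u = awaited c B u (walk_pos c B u)")
    case True
    then show ?thesis
      using walk_acts [of c B u] walk_pos_le [of c B u] by (simp add: wins_def)
  next
    case False
    then show ?thesis
      using walk_pos_le [of c B u] by (auto simp: walk_Suc advance_def)
  qed
  with step.IH show ?case by (meson le_trans less_le_trans)
qed simp

lemma walk_set_iff:
  assumes "x < walk_pos c B s"
  shows "x \<in> walk_set c B \<longleftrightarrow> x \<in> set_decode (pair2 (walk c B s))"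
proof -
  define u where "u = (LEAST s. x < walk_pos c B s)"
  have u: "x < walk_pos c B u" "u \<le> s"
    unfolding u_def using assms by (rule LeastI, rule Least_le)
  then show ?thesis
    using walk_coherent [OF u(2), of c B] by (simp add: walk_set_def flip: u_def)
qed

text \<open>After the last injury the counter passes the value chosen by \<open>B\<close>, at a
  stage where the walk is in place and adopts a winning extension. The string used there is an
  initial part of the limit \<open>t\<close>, hence of \<open>A\<close>, so the enumeration is
  correct for \<open>A\<close>.\<close>

lemma walk_set_meets:
  fixes p \<sigma> c
  defines "j \<equiv> prod_encode (code_num p, \<sigma>)"
  assumes B: "walk_total c B"
    and D: "string_num ` D = dom (eval A p)" "dense_strings D"
    and t: "\<And>s. s \<ge> q \<Longrightarrow> str (state c s j) = t" "agrees t A"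
  shows "\<exists>n. initial_segment (walk_set c B) n \<in> D"
proof -
  obtain q' v where v: "\<And>s. s \<ge> q' \<Longrightarrow> state c s j = v"
    using state_converges by blast
  have "str v = t" using v [of "max q q'"] t(1) [of "max q q'"] by simp
  have "2 ^ (j + c) \<le> cnt v"
    unfolding j_def
    by (rule counter_exhausted [OF D, of q']) (use v t \<open>str v = t\<close> in \<open>simp_all add: j_def\<close>)
  moreover have "attempt B (j + c) < 2 ^ (j + c)"
    unfolding attempt_def by (rule set_encode_less_power)
  ultimately have large: "attempt B (j + c) < cnt (state c s j)" if "s \<ge> q'" for s
    using v [OF that] by simp
  obtain r where r: "\<And>s. s \<ge> r \<Longrightarrow> fired c s \<Longrightarrow> j \<le> stage_req s" "cnt (state c r j) = 0"
    using final_run by blast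
  obtain s where s: "s \<ge> r" "fired c s" "stage_req s = j" "cnt (state c s j) = attempt B (j + c)"
    using counter_crossing [OF r large] by blast
  have "awaited c B s (walk_pos c B s) = j" "pos (state c s j) = walk_pos c B s"
    by (rule walk_reaches_attempt [OF B s(3,4)], use r(1) s(1) in \<open>meson le_trans\<close>)+
  then have w: "wins s (walk_pos c B s) (pair2 (walk c B s)) (pair2 (walk c B (Suc s)))"
    "walk_pos c B (Suc s) = Suc s"
    using walk_acts [of c B s] s(2,3) le_pos_state [of j c s] by auto
  then obtain m where m: "m < s" "halts_by (stage_str s) s (code_num p) (string_num (bits m (pair2 (walk c B (Suc s)))))"
    unfolding wins_def s(3) by (auto simp: j_def)
  have "str (state c (Suc s) j) = stage_str s"
    using s by (simp add: state_Suc update_def)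
  then have "extends t (stage_str s)"
    using str_state_mono [of "Suc s" "max q (Suc s)" c j] t(1) [of "max q (Suc s)"] by simp
  then have "agrees (stage_str s) A" using t(2) by (rule agrees_extends)
  with m(2) have "string_num (bits m (pair2 (walk c B (Suc s)))) \<in> string_num ` D"
    unfolding D(1) by (rule halts_by_sound)
  then have "bits m (pair2 (walk c B (Suc s))) \<in> D" by auto
  moreover have "bits m (pair2 (walk c B (Suc s))) = initial_segment (walk_set c B) m"
    unfolding bits_eq_initial_segment_iff
    using w(2) m(1) walk_set_iff [of _ c B "Suc s"] by simp
  ultimately show ?thesis by metis
qed

lemma walk_set_weakly_1_generic:
  assumes B: "walk_total c B" and A: "weakly_2_generic A"
  shows "weakly_1_generic_in A (walk_set c B)"
  unfolding weakly_1_generic_in_def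
proof (intro allI impI)
  fix D assume "dense_strings D \<and> ce_strings_in A D"
  then obtain p where D: "dense_strings D" "string_num ` D = dom (eval A p)"
    unfolding ce_strings_in_def ce_in_def by blast
  define req where "req \<sigma> = prod_encode (code_num p, \<sigma>)" for \<sigma>
  \<comment> \<open>The limit strings of all requirements for \<open>p\<close>. The construction
    does not consult \<open>B\<close>, so neither does \<open>E\<close>, and being a limit is a
    Sigma-2 condition.\<close>
  define E where "E = {bits (pair1 t) (pair2 t) |t. \<exists>\<sigma> q. \<forall>z. q \<le> z \<longrightarrow> str (state c z (req \<sigma>)) = t}"
  have "dense_strings E"
    unfolding dense_strings_def
  proof
    fix s
    obtain b where b: "bits (length s) b = s" using bits_surj by blast
    define \<sigma> where "\<sigma> = prod_encode (length s, b)"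
    obtain q v where v: "\<And>z. z \<ge> q \<Longrightarrow> state c z (req \<sigma>) = v" using state_converges by blast
    \<comment> \<open>The string of this requirement starts as \<sigma> and only grows.\<close>
    have "extends (str v) \<sigma>"
      using str_state_mono [of 0 q c "req \<sigma>"] v [of q] by (simp add: state_0 req_def)
    then have ext: "length s \<le> pair1 (str v)"
      "\<And>i. i < length s \<Longrightarrow> i \<in> set_decode (pair2 (str v)) \<longleftrightarrow> i \<in> set_decode b"
      by (auto simp: extends_def \<sigma>_def)
    have "take (length s) (bits (pair1 (str v)) (pair2 (str v))) = bits (length s) b"
      by (rule nth_equalityI) (use ext in auto)
    then have "prefix s (bits (pair1 (str v)) (pair2 (str v)))"
      unfolding b by (metis take_is_prefix)
    moreover have "bits (pair1 (str v)) (pair2 (str v)) \<in> E"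
      unfolding E_def using v by blast
    ultimately show "\<exists>t\<in>E. prefix s t" by blast
  qed
  moreover have "ce_strings_in (turing_jump {}) E"
  proof -
    \<comment> \<open>The existential witness codes the limit string, the starting string and a
      stage from which the limit is attained.\<close>
    define R where "R w z \<longleftrightarrow>
      pair1 w = string_num (bits (pair1 (pair1 (pair2 w))) (pair2 (pair1 (pair2 w)))) \<and>
      (pair2 (pair2 (pair2 w)) \<le> z \<longrightarrow>
         str (state c z (req (pair1 (pair2 (pair2 w))))) = pair1 (pair2 w))" for w z
    have "ce_in (turing_jump {}) {x. \<exists>y. \<forall>z. R (prod_encode (x, y)) z}"
    proof (rule ce_in_jump)
      show "decidable_in {} (\<lambda>v. R (pair1 v) (pair2 v))"
        unfolding R_def req_def by (intro computable)
    qed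
    also have "{x. \<exists>y. \<forall>z. R (prod_encode (x, y)) z} = string_num ` E"
    proof (intro equalityI subsetI)
      fix x assume "x \<in> {x. \<exists>y. \<forall>z. R (prod_encode (x, y)) z}"
      then show "x \<in> string_num ` E" by (auto simp: R_def E_def)
    next
      fix x assume "x \<in> string_num ` E"
      then obtain t \<sigma> q where x: "x = string_num (bits (pair1 t) (pair2 t))"
        "\<forall>z. q \<le> z \<longrightarrow> str (state c z (req \<sigma>)) = t"
        unfolding E_def by blast
      then have "\<forall>z. R (prod_encode (x, prod_encode (t, prod_encode (\<sigma>, q)))) z"
        by (simp add: R_def)
      then show "x \<in> {x. \<exists>y. \<forall>z. R (prod_encode (x, y)) z}" by blast
    qed
    finally show ?thesis unfolding ce_strings_in_def .
  qed
  ultimately obtain n where "initial_segment A n \<in> E"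
    using A unfolding weakly_2_generic_def by blast
  then obtain t \<sigma> q where t: "initial_segment A n = bits (pair1 t) (pair2 t)"
    "\<And>z. q \<le> z \<Longrightarrow> str (state c z (req \<sigma>)) = t"
    unfolding E_def by blast
  have "n = pair1 t" using arg_cong [OF t(1), of length] by (simp add: initial_segment_def)
  with t(1) have "agrees t A"
    unfolding agrees_def bits_eq_initial_segment_iff [symmetric] by simp
  then show "\<exists>n. initial_segment (walk_set c B) n \<in> D"
    using walk_set_meets [OF B D(2,1), of q \<sigma> t] t(2) unfolding req_def by blast
qed


section \<open>Almost every walk is total\<close>

abbreviation coin_space :: "(nat \<Rightarrow> bool) measure" where
  "coin_space \<equiv> \<Pi>\<^sub>M n\<in>UNIV. measure_pmf (bernoulli_pmf (1/2))"

interpretation coin_space: product_prob_space "\<lambda>_. measure_pmf (bernoulli_pmf (1/2))" "UNIV :: nat set"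
  by unfold_locales

lemma coin_space_cylinder:
  shows "{\<omega> \<in> space coin_space. \<forall>i<m. \<omega> i = v i} \<in> sets coin_space"
    and "measure coin_space {\<omega> \<in> space coin_space. \<forall>i<m. \<omega> i = v i} = (1/2) ^ m"
proof -
  let ?C = "{\<omega> \<in> space coin_space. \<forall>i<m. \<omega> i = v i}"
  have C: "?C = {\<omega> \<in> space coin_space. \<forall>i\<in>{..<m}. \<omega> i \<in> {v i}}" by auto
  show "?C \<in> sets coin_space"
    unfolding C by (intro sets.sets_Collect_finite_All sets_Collect_single') auto
  have "emeasure coin_space ?C = (\<Prod>i<m. emeasure (measure_pmf (bernoulli_pmf (1/2))) {v i})"
    unfolding C by (rule coin_space.emeasure_PiM_Collect) auto
  also have "\<dots> = (\<Prod>i<m. ennreal (1/2))"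
  proof (rule prod.cong)
    show "emeasure (measure_pmf (bernoulli_pmf (1/2))) {v i} = ennreal (1/2)" for i
    proof -
      have "pmf (bernoulli_pmf (1/2)) (v i) = 1/2" by (cases "v i") simp_all
      then show ?thesis by (simp only: emeasure_pmf_single)
    qed
  qed simp
  also have "\<dots> = ennreal ((1/2) ^ m)"
    by (subst prod_ennreal) auto
  finally show "measure coin_space ?C = (1/2) ^ m"
    by (simp add: measure_eq_emeasure_eq_ennreal)
qed

lemma AE_uniform_measure_sets_iff:
  "(AE B in uniform_measure_sets. P B) \<longleftrightarrow> (AE \<omega> in coin_space. P (Collect \<omega>))"
  unfolding uniform_measure_sets_def by (rule AE_embed_measure) (simp add: inj_def Collect_inj)

lemma AE_walk_total: "AE B in uniform_measure_sets. \<exists>c. walk_total c B"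
proof -
  have "\<exists>v. \<exists>r. \<forall>s\<ge>r. state c s j = v" for c j
    using state_converges [of c j] by metis
  then obtain v where v: "\<And>c j. \<exists>r. \<forall>s\<ge>r. state c s j = v c j" by metis
  \<comment> \<open>The sets whose chosen attempt for \<open>j\<close> is the one numbered by the
    final counter, the only attempt for \<open>j\<close> that can stay pending forever. A set whose
    walk is stuck for every \<open>c\<close> lies in \<open>N\<close>.\<close>
  define C where "C c j = {\<omega> \<in> space coin_space. \<forall>i<j + c. \<omega> i = (i \<in> set_decode (cnt (v c j)))}" for c j
  define N where "N = (\<Inter>c. \<Union>j. C c j)"
  have C: "C c j \<in> sets coin_space" "measure coin_space (C c j) = (1/2) ^ (j + c)" for c j
    unfolding C_def by (rule coin_space_cylinder)+
  have N: "N \<in> sets coin_space" unfolding N_def using C(1) by (intro sets.countable_INT' sets.countable_UN) auto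
  have bound: "measure coin_space N \<le> 2 * (1/2) ^ c" for c
  proof -
    have sums: "(\<lambda>j. (1/2) ^ (j + c)) sums (2 * (1/2) ^ c :: real)"
      using sums_mult2 [OF geometric_sums [of "1/2 :: real"], of "(1/2) ^ c"]
      by (simp add: power_add)
    have "measure coin_space N \<le> measure coin_space (\<Union>j. C c j)"
      unfolding N_def using C(1) by (intro coin_space.finite_measure_mono sets.countable_UN) auto
    also have "\<dots> \<le> (\<Sum>j. measure coin_space (C c j))"
      using C sums by (intro coin_space.finite_measure_subadditive_countably) (auto simp: sums_iff)
    also have "\<dots> = 2 * (1/2) ^ c"
      using sums by (simp add: C(2) sums_iff)
    finally show ?thesis .
  qed
  have "(\<lambda>c. 2 * (1/2) ^ c) \<longlonglongrightarrow> (2 * 0 :: real)"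
    by (intro tendsto_mult tendsto_const LIMSEQ_power_zero) simp
  then have "measure coin_space N \<le> 2 * 0"
    by (rule LIMSEQ_le_const) (use bound in blast)
  then have "measure coin_space N = 0" using measure_nonneg [of coin_space N] by simp
  then have "N \<in> null_sets coin_space"
    using N by (simp add: null_sets_def coin_space.emeasure_eq_measure)
  moreover have "{\<omega> \<in> space coin_space. \<not> (\<exists>c. walk_total c (Collect \<omega>))} \<subseteq> N"
  proof
    fix \<omega> assume "\<omega> \<in> {\<omega> \<in> space coin_space. \<not> (\<exists>c. walk_total c (Collect \<omega>))}"
    then have \<omega>: "\<omega> \<in> space coin_space" "\<And>c. \<not> walk_total c (Collect \<omega>)" by auto
    show "\<omega> \<in> N"
      unfolding N_def
    proof
      fix c
      obtain j r where j: "\<And>s. s \<ge> r \<Longrightarrow> cnt (state c s j) = attempt (Collect \<omega>) (j + c)"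
        using not_walk_total_attempt [OF \<omega>(2)] by blast
      obtain q where "\<And>s. s \<ge> q \<Longrightarrow> state c s j = v c j" using v by blast
      with j [of "max q r"] have "cnt (v c j) = attempt (Collect \<omega>) (j + c)" by simp
      then have "set_decode (cnt (v c j)) = Collect \<omega> \<inter> {..<j + c}"
        by (simp add: attempt_def)
      then have "\<omega> \<in> C c j" using \<omega>(1) by (auto simp: C_def)
      then show "\<omega> \<in> (\<Union>j. C c j)" by blast
    qed
  qed
  ultimately have "AE \<omega> in coin_space. \<exists>c. walk_total c (Collect \<omega>)"
    by (rule AE_I')
  then show ?thesis by (simp only: AE_uniform_measure_sets_iff)
qed

lemma not_AE_False: "\<not> (AE B in uniform_measure_sets. False)"
  unfolding AE_uniform_measure_sets_iff by (simp add: coin_space.AE_False)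


section \<open>Generic sets and coarse distance\<close>

text \<open>Any string can be continued by a long run of the complement of \<open>X\<close>, which
  outweighs it; since \<open>X\<close> is computable from \<open>A\<close>, the resulting dense sets
  are c.e. in \<open>A\<close>, and \<open>G\<close> meets all of them.\<close>

lemma upper_density_generic:
  assumes G: "weakly_1_generic_in A G" and X: "X \<le>\<^sub>T A"
  shows "1 \<le> upper_density (sym_diff G X)"
proof (rule ccontr)
  define diffs where "diffs l a = card {i. i < l \<and> (i \<in> set_decode a \<longleftrightarrow> i \<notin> X)}" for l a
  \<comment> \<open>Without division: the share of differences from \<open>X\<close> is at least
    \<open>k / (k + 1)\<close>. The condition \<open>k < l\<close> forces the strings to be
    long.\<close>
  define D where "D k = {bits l a |l a. k < l \<and> k * l \<le> Suc k * diffs l a}" for k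
  have dense_D: "dense_strings (D k)" for k
    unfolding dense_strings_def
  proof
    fix s :: "bool list"
    define n where "n = length s"
    \<comment> \<open>At most \<open>n\<close> places agree with \<open>X\<close>, a share of at
      most \<open>1 / (k + 1)\<close> of this length; the summand \<open>Suc k\<close> yields
      \<open>k < l\<close> even for \<open>n = 0\<close>.\<close>
    define l where "l = Suc k * n + Suc k"
    define a where "a = set_encode {i. i < l \<and> (if i < n then s ! i else i \<notin> X)}"
    have a: "i \<in> set_decode a \<longleftrightarrow> (if i < n then s ! i else i \<notin> X)" if "i < l" for i
      using that by (simp add: a_def)
    have "n \<le> l" by (simp add: l_def)
    have "{n..<l} \<subseteq> {i. i < l \<and> (i \<in> set_decode a \<longleftrightarrow> i \<notin> X)}" using a by auto
    then have "card {n..<l} \<le> diffs l a" unfolding diffs_def by (intro card_mono) auto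
    then have "l \<le> diffs l a + n" by simp
    then have "Suc k * l \<le> Suc k * diffs l a + Suc k * n"
      by (metis add_mult_distrib2 mult_le_mono2)
    moreover have "Suc k * n \<le> l" by (simp add: l_def)
    ultimately have "k * l \<le> Suc k * diffs l a" by simp
    moreover have "k < l" by (simp add: l_def)
    ultimately have "bits l a \<in> D k" unfolding D_def by blast
    moreover have "take n (bits l a) = s"
      by (rule nth_equalityI) (use a \<open>n \<le> l\<close> in \<open>auto simp: n_def\<close>)
    then have "prefix s (bits l a)" by (metis take_is_prefix)
    ultimately show "\<exists>t\<in>D k. prefix s t" by blast
  qed
  have diffs_rec: "diffs l a = rec_nat 0 (\<lambda>i r. r + of_bool ((i \<in> set_decode a \<longrightarrow> i \<notin> X) \<and>
      (i \<notin> X \<longrightarrow> i \<in> set_decode a))) l" for l a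
  proof (induction l)
    case (Suc l)
    have "{i. i < Suc l \<and> (i \<in> set_decode a \<longleftrightarrow> i \<notin> X)} =
      (if l \<in> set_decode a \<longleftrightarrow> l \<notin> X then insert l {i. i < l \<and> (i \<in> set_decode a \<longleftrightarrow> i \<notin> X)}
       else {i. i < l \<and> (i \<in> set_decode a \<longleftrightarrow> i \<notin> X)})"
      by (auto simp: less_Suc_eq)
    then show ?case using Suc by (auto simp: diffs_def)
  qed (simp add: diffs_def)
  have dec_X: "decidable_in A (\<lambda>n. f n \<in> X)" if "computable_in A f" for f
    using computable_comp [OF _ that] X unfolding turing_reducible_iff by blast
  have ce: "ce_strings_in A (D k)" for k
  proof -
    have "ce_in A {x. \<exists>t. x = string_num (bits (pair1 t) (pair2 t)) \<and> k < pair1 t \<and>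
        k * pair1 t \<le> Suc k * diffs (pair1 t) (pair2 t)}"
    proof (rule ce_in_projection)
      show "decidable_in A (\<lambda>z. pair1 z = string_num (bits (pair1 (pair2 z)) (pair2 (pair2 z))) \<and>
        k < pair1 (pair2 z) \<and>
        k * pair1 (pair2 z) \<le> Suc k * diffs (pair1 (pair2 z)) (pair2 (pair2 z)))"
        unfolding diffs_rec by (intro computable dec_X)
    qed
    also have "{x. \<exists>t. x = string_num (bits (pair1 t) (pair2 t)) \<and> k < pair1 t \<and>
        k * pair1 t \<le> Suc k * diffs (pair1 t) (pair2 t)} = string_num ` D k"
      unfolding D_def by (auto simp: image_def) (metis fst_conv prod_encode_inverse snd_conv)
    finally show ?thesis unfolding ce_strings_in_def .
  qed
  assume "\<not> 1 \<le> upper_density (sym_diff G X)"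
  then obtain y where y: "upper_density (sym_diff G X) < y" "y < 1"
    by (metis dense not_le)
  have "limsup (\<lambda>n. ereal (partial_density n (sym_diff G X))) < ereal y"
    using y(1) by (simp flip: ereal_upper_density)
  then have "\<forall>\<^sub>F n in sequentially. ereal (partial_density n (sym_diff G X)) < ereal y"
    by (rule Limsup_lessD)
  then obtain n0 where n0: "\<And>n. n \<ge> n0 \<Longrightarrow> partial_density n (sym_diff G X) < y"
    unfolding eventually_sequentially by auto
  \<comment> \<open>For \<open>k \<ge> k0\<close> this gives \<open>k * (1 - y) > 1 > y\<close>,
    that is, \<open>k / (k + 1) > y\<close>.\<close>
  obtain k0 :: nat where k0: "1 / (1 - y) < real k0" using reals_Archimedean2 by blast
  define k where "k = max n0 k0"
  obtain n where "initial_segment G n \<in> D k"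
    using G dense_D ce unfolding weakly_1_generic_in_def by blast
  then obtain l a where la: "bits l a = initial_segment G n" "k < l" "k * l \<le> Suc k * diffs l a"
    unfolding D_def by fastforce
  have "l = n" using arg_cong [OF la(1), of length] by (simp add: initial_segment_def)
  then have "i \<in> set_decode a \<longleftrightarrow> i \<in> G" if "i < l" for i
    using la(1) that by (simp add: bits_eq_initial_segment_iff)
  then have "{i. i < l \<and> (i \<in> set_decode a \<longleftrightarrow> i \<notin> X)} = sym_diff G X \<inter> {0..<l}"
    by auto
  then have "diffs l a = card (sym_diff G X \<inter> {0..<l})" by (simp add: diffs_def)
  then have "real (diffs l a) < y * real l"
    using n0 [of l] la(2) by (simp add: partial_density_def k_def field_simps)
  have "real k * real l \<le> real (Suc k) * real (diffs l a)"
    using la(3) by (metis of_nat_le_iff of_nat_mult)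
  also have "\<dots> < real (Suc k) * (y * real l)"
    using \<open>real (diffs l a) < y * real l\<close> by (intro mult_strict_left_mono) auto
  finally have "real k * real l < (real (Suc k) * y) * real l" by (simp only: mult.assoc)
  then have "real k < real (Suc k) * y" using la(2) by simp
  then have "real k * (1 - y) < y" by (simp add: algebra_simps)
  moreover have "1 < real k0 * (1 - y)" using k0 y(2) by (simp add: field_simps)
  moreover have "real k0 * (1 - y) \<le> real k * (1 - y)"
    using y(2) by (intro mult_right_mono) (auto simp: k_def)
  ultimately show False using y(2) by linarith
qed

text \<open>The class of \<open>G\<close> stays at distance at least 1 from the closure belonging to
  \<open>A\<close>, which makes the Hausdorff distance at least 1 for almost every
  \<open>B\<close>.\<close>

lemma dispersiveI:
  assumes "AE B in uniform_measure_sets. \<exists>G. G \<le>\<^sub>T B \<and> weakly_1_generic_in A G"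
  shows "dispersive A"
proof -
  have "degree_distance A B \<noteq> 1/2" if G: "G \<le>\<^sub>T B" "weakly_1_generic_in A G" for B G
  proof -
    define S where "S = closure (coarse_class ` {X. X \<le>\<^sub>T A})"
    define T where "T = closure (coarse_class ` {X. X \<le>\<^sub>T B})"
    have dist_class: "dist (coarse_class Y) (coarse_class Z) = upper_density (sym_diff Y Z)" for Y Z
      by (rule dist_coarse_class.abs_eq)
    \<comment> \<open>The bound on distances makes the real-valued supremum in
      \<open>hausdorff_distance\<close> an actual upper bound.\<close>
    have dist_le: "dist x y \<le> 1" for x y :: coarse_class
    proof -
      have ex: "\<exists>Y. z = coarse_class Y" for z
        by (rule coarse_class.abs_induct [of _ z]) blast
      obtain Y Z where "x = coarse_class Y" "y = coarse_class Z"
        using ex by blast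
      then show ?thesis
        using limsup_partial_density_bounds(2) [of "sym_diff Y Z"]
        by (simp add: dist_class flip: ereal_upper_density)
    qed
    have "computable_in A (\<lambda>n. 0)" by (rule computable_const)
    then have "{} \<le>\<^sub>T A" by (simp add: turing_reducible_iff)
    then have ne: "coarse_class {} \<in> S" unfolding S_def by (intro subsetD [OF closure_subset]) blast
    have "1 \<le> dist (coarse_class G) y" if "y \<in> S" for y
    proof (rule field_le_epsilon)
      fix e :: real assume "0 < e"
      with that obtain X where X: "X \<le>\<^sub>T A" "dist (coarse_class X) y < e"
        unfolding S_def closure_approachable by blast
      have "1 \<le> dist (coarse_class G) (coarse_class X)"
        unfolding dist_class using upper_density_generic [OF G(2) X(1)] .
      also have "\<dots> \<le> dist (coarse_class G) y + dist (coarse_class X) y"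
        by (rule dist_triangle2)
      finally show "1 \<le> dist (coarse_class G) y + e" using X(2) by simp
    qed
    then have "1 \<le> infdist (coarse_class G) S"
      using ne unfolding infdist_def by (auto intro!: cINF_greatest)
    also have "\<dots> \<le> (SUP y\<in>T. infdist y S)"
    proof (rule cSUP_upper)
      show "coarse_class G \<in> T" unfolding T_def using G(1) by (intro subsetD [OF closure_subset]) blast
      show "bdd_above ((\<lambda>y. infdist y S) ` T)"
        by (rule bdd_aboveI2 [of _ _ 1]) (rule infdist_le2 [OF ne dist_le])
    qed
    also have "\<dots> \<le> degree_distance A B"
      unfolding degree_distance_def hausdorff_distance_def S_def T_def by simp
    finally show ?thesis by simp
  qed
  then have neq: "AE B in uniform_measure_sets. degree_distance A B \<noteq> 1/2"
    using assms by (auto elim!: eventually_mono)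
  show ?thesis
    unfolding dispersive_def
  proof
    assume "AE B in uniform_measure_sets. degree_distance A B = 1/2"
    with neq have "AE B in uniform_measure_sets. False" by eventually_elim simp
    with not_AE_False show False ..
  qed
qed

theorem theorem5p16:
  shows "(\<forall>A. weakly_2_generic A \<longrightarrow>
            (AE B in uniform_measure_sets. \<exists>G. G \<le>\<^sub>T B \<and> weakly_1_generic_in A G) \<and>
            dispersive A) \<and>
         (AE B in uniform_measure_sets.
            \<exists>G. G \<le>\<^sub>T B \<and> (\<forall>A. weakly_2_generic A \<longrightarrow> weakly_1_generic_in A G))"
proof -
  have uniform: "AE B in uniform_measure_sets.
      \<exists>G. G \<le>\<^sub>T B \<and> (\<forall>A. weakly_2_generic A \<longrightarrow> weakly_1_generic_in A G)"
    using AE_walk_total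
    by (rule eventually_mono) (blast intro: walk_set_reducible walk_set_weakly_1_generic)
  have "AE B in uniform_measure_sets. \<exists>G. G \<le>\<^sub>T B \<and> weakly_1_generic_in A G"
    if "weakly_2_generic A" for A
    using uniform by (rule eventually_mono) (use that in blast)
  with uniform dispersiveI show ?thesis by blast
qed

end
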